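(* Let $V=\{1,\dots,n\}$ and $\mathcal{H}=\bigotimes_{v\in V}\mathcal{H}^v$ with $\dim\mathcal{H}^v=d$. Let $k\ge 1$ and $g>0$. Let $H=\sum_{X\subseteq V,\,|X|\le k} h_X$, where each $h_X$ is a Hermitian operator on $\mathcal{H}$ supported on $X$, with $\sum_{X:X\ni v}\|h_X\|\le g$ for all $v\in V$. Let $\mathcal{F}=\sum_{X\subseteq V,\,|X|\le k} f_X$, where each $f_X$ is a Hermitian operator supported on $X$, with $\sum_{X:X\ni v}\|f_X\|\le g$ for all $v\in V$, and set $\bar{\mathcal{F}}:=\sum_{|X|\le k}\|f_X\|$. Let $\beta\ge 0$, $\rho=e^{-\beta H}/Z$ with $Z=\mathrm{tr}(e^{-\beta H})$, and $\langle\mathcal{F}\rangle_\beta:=\mathrm{tr}(\mathcal{F}\rho)$. If $$\beta<\beta_c:=\frac{1}{8e^3gk},$$ then for every real $\tau$ with $|\tau|<\beta_c-\beta$, $$\log\big[\mathrm{tr}(e^{-\tau\mathcal{F}}\rho)\big]\le -\tau\langle\mathcal{F}\rangle_\beta+\frac{\tau^2\bar{\mathcal{F}}}{\beta_c-\beta-|\tau|}.$$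
   Context: $\|\cdot\|$ is the operator norm. An operator "supported on $X$" acts as the identity on $\bigotimes_{v\notin X}\mathcal{H}^v$. The sums $\sum_{X:X\ni v}$ run over all subsets $X\subseteq V$ with $|X|\le k$ containing $v$. *)

theory Defs
  imports "HOL-Analysis.Analysis"
begin

text \<open>Spin system on sites V = UNIV :: 'v set (n = CARD('v)), each site carrying a
 d-dimensional Hilbert space with d = CARD('q). The total Hilbert space is
 spanned by the configurations 'v \<Rightarrow> 'q; operators are square complex matrices
 indexed by configurations.\<close>

type_synonym ('v, 'q) op = "complex ^ ('v \<Rightarrow> 'q) ^ ('v \<Rightarrow> 'q)"

primrec mat_pow :: "'a::semiring_1 ^ 'n ^ 'n \<Rightarrow> nat \<Rightarrow> 'a ^ 'n ^ 'n" where
  "mat_pow A 0 = mat 1"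
| "mat_pow A (Suc m) = A ** mat_pow A m"

definition mat_exp :: "complex ^ 'n ^ 'n \<Rightarrow> complex ^ 'n ^ 'n" where
  "mat_exp A = (\<Sum>m. (1 / fact m) *\<^sub>R mat_pow A m)"

definition op_norm :: "complex ^ 'n ^ 'n \<Rightarrow> real" where
  "op_norm A = onorm (\<lambda>x. A *v x)"

definition hermitian :: "complex ^ 'n ^ 'n \<Rightarrow> bool" where
  "hermitian A \<longleftrightarrow> (\<forall>i j. A $ i $ j = cnj (A $ j $ i))"

text \<open>An operator is supported on X iff it is of the form a_X \<otimes> identity on the
 complement of X: its matrix entries vanish unless the two configurations agree
 off X, and otherwise depend only on the restrictions of the configurations to X.\<close>
definition supported_on :: "'v::finite set \<Rightarrow> ('v, 'q::finite) op \<Rightarrow> bool" where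
  "supported_on X A \<longleftrightarrow>
     (\<exists>a :: ('v \<Rightarrow> 'q) \<Rightarrow> ('v \<Rightarrow> 'q) \<Rightarrow> complex.
        (\<forall>s t s' t'. (\<forall>v\<in>X. s v = s' v \<and> t v = t' v) \<longrightarrow> a s t = a s' t') \<and>
        (\<forall>s t. A $ s $ t = (if (\<forall>v. v \<notin> X \<longrightarrow> s v = t v) then a s t else 0)))"

end

theory Submission
  imports Defs "HOL-Complex_Analysis.Cauchy_Integral_Formula"
begin

text \<open>
  For complex \<open>z\<close> put \<open>Z(z) = tr (exp (z F) exp (- \<beta> H))\<close> and \<open>R = \<beta>\<^sub>c - \<beta>\<close>. The point is the
  locality estimate \<open>|tr (b exp (z F) exp (- \<beta> H))| \<le> 2 \<parallel>b\<parallel> |Z(z)|\<close> for \<open>|z| \<le> R\<close> and every \<open>b\<close>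
  supported on at most \<open>k\<close> sites. Summing it over the terms of \<open>F\<close> gives \<open>|Z'| \<le> 2 Fbar |Z|\<close> and
  \<open>Z \<noteq> 0\<close> on the disc, so Cauchy's inequality bounds \<open>(log Z)''\<close> at \<open>s\<close> by \<open>2 Fbar / (R - |s|)\<close>, and
  the second-order Taylor formula for \<open>log Z\<close> is the claim.

  To prove the locality estimate, approximate the two exponentials by ordered products of factors
  \<open>1 + a\<^sub>i\<close>, where \<open>a\<^sub>i\<close> is a small multiple of a single interaction term, supported on \<open>X\<^sub>i\<close>.
  Expand, one at a time, the factors whose support meets the support \<open>S\<close> of the observable: choosing
  \<open>1\<close> deletes the factor, choosing \<open>a\<^sub>i\<close> costs \<open>\<parallel>a\<^sub>i\<parallel>\<close> and enlarges \<open>S\<close> to \<open>S \<union> X\<^sub>i\<close>. Once no factor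
  meets \<open>S\<close>, the normalised trace factorises. The same expansion bounds the change of the trace
  when a factor is deleted, so the number of active factors serves as the induction parameter and no
  cluster sums occur.
\<close>

subsection \<open>The Chernoff product formula\<close>

lemma norm_power_diff_le:
  fixes p q :: "'a::real_normed_algebra_1"
  assumes "norm p \<le> C" "norm q \<le> C" "1 \<le> C"
  shows "norm (p ^ n - q ^ n) \<le> n * C ^ n * norm (p - q)"
proof (induction n)
  case (Suc n)
  have "p ^ Suc n - q ^ Suc n = p * (p ^ n - q ^ n) + (p - q) * q ^ n"
    by (simp add: algebra_simps)
  then have "norm (p ^ Suc n - q ^ Suc n)
      \<le> norm p * norm (p ^ n - q ^ n) + norm (p - q) * norm (q ^ n)"
    by (metis (no_types, lifting) norm_triangle_le add_mono norm_mult_ineq)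
  also have "\<dots> \<le> C * (n * C ^ n * norm (p - q)) + norm (p - q) * (C * C ^ n)"
  proof (intro add_mono mult_mono)
    have "norm (q ^ n) \<le> C ^ n"
      by (rule order_trans[OF norm_power_ineq]) (simp add: power_mono assms)
    also have "\<dots> \<le> C * C ^ n" using assms by simp
    finally show "norm (q ^ n) \<le> C * C ^ n" .
  qed (use assms Suc.IH in auto)
  finally show ?case by (simp add: algebra_simps)
qed simp

lemma norm_power_diff_le_exp:
  fixes p q :: "'a::real_normed_algebra_1"
  assumes "norm p \<le> 1 + C / n" "norm q \<le> 1 + C / n" "0 \<le> C" "0 < n"
  shows "norm (p ^ n - q ^ n) \<le> exp C * (n * norm (p - q))"
proof -
  have "norm (p ^ n - q ^ n) \<le> n * (1 + C / n) ^ n * norm (p - q)"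
    using assms by (intro norm_power_diff_le) auto
  also have "(1 + C / n) ^ n \<le> exp C"
    using assms by (intro exp_ge_one_plus_x_over_n_power_n) auto
  finally show ?thesis by (simp add: mult_ac mult_left_mono mult_right_mono)
qed

lemma exp_scaleR_of_nat: "exp (of_nat n *\<^sub>R a) = exp a ^ n"
  for a :: "'a::{real_normed_algebra_1,banach}"
proof (induction n)
  case (Suc n)
  have "exp (of_nat (Suc n) *\<^sub>R a) = exp (a + of_nat n *\<^sub>R a)" by (simp add: algebra_simps)
  also have "\<dots> = exp a * exp (of_nat n *\<^sub>R a)" by (rule exp_add_commuting) simp
  finally show ?case using Suc by simp
qed simp

lemma has_vector_derivative_at_right_imp_tendsto:
  assumes "(p has_vector_derivative s) (at_right a)"
  shows "((\<lambda>x. (p x - p a) /\<^sub>R (x - a)) \<longlongrightarrow> s) (at_right a)"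
proof -
  have "((\<lambda>x. (p x - p a - (x - a) *\<^sub>R s) /\<^sub>R norm (x - a)) \<longlongrightarrow> 0) (at_right a)"
    using assms
    by (simp add: has_vector_derivative_def has_derivative_within diff_diff_eq inverse_eq_divide)
  moreover have "\<forall>\<^sub>F x in at_right a.
      (p x - p a - (x - a) *\<^sub>R s) /\<^sub>R norm (x - a) = (p x - p a) /\<^sub>R (x - a) - s"
    using eventually_at_right_less by eventually_elim (simp add: scaleR_diff_right)
  ultimately have "((\<lambda>x. (p x - p a) /\<^sub>R (x - a) - s) \<longlongrightarrow> 0) (at_right a)"
    by (rule Lim_transform_eventually)
  then show ?thesis by (rule LIM_zero_cancel)
qed

lemma eventually_norm_le_one_plus:
  fixes p :: "real \<Rightarrow> 'a::real_normed_algebra_1"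
  assumes "p 0 = 1" "(p has_vector_derivative s) (at_right 0)" "norm s < C"
  shows "\<forall>\<^sub>F x in at_right 0. norm (p x) \<le> 1 + C * x"
proof -
  have "((\<lambda>x. norm ((p x - 1) /\<^sub>R x)) \<longlongrightarrow> norm s) (at_right 0)"
    using has_vector_derivative_at_right_imp_tendsto[OF assms(2)] assms(1)
    by (intro tendsto_norm) simp
  then have "\<forall>\<^sub>F x in at_right 0. norm ((p x - 1) /\<^sub>R x) < C"
    using assms(3) by (rule order_tendstoD)
  then show ?thesis
    using eventually_at_right_less
  proof eventually_elim
    case (elim x)
    have "norm (p x) \<le> 1 + norm (p x - 1)"
      using norm_triangle_ineq[of 1 "p x - 1"] by simp
    moreover have "norm (p x - 1) < C * x"
      using elim by (simp only: norm_scaleR) (simp add: field_simps)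
    ultimately show ?case by linarith
  qed
qed

theorem Chernoff_product_formula:
  fixes p :: "real \<Rightarrow> 'a::{real_normed_algebra_1,banach}"
  assumes p: "p 0 = 1" "(p has_vector_derivative s) (at_right 0)"
  shows "(\<lambda>n. p (inverse (real n)) ^ n) \<longlonglongrightarrow> exp s"
proof -
  let ?x = "\<lambda>n. inverse (real n)"
  define q where "q = (\<lambda>x. exp (x *\<^sub>R s))"
  define C where "C = norm s + 1"
  have q: "q 0 = 1" "(q has_vector_derivative s) (at_right 0)"
    using exp_scaleR_has_vector_derivative_left[of s 0]
    by (simp_all add: q_def has_vector_derivative_at_within)
  have at_right: "filterlim ?x (at_right 0) sequentially"
    by (rule filterlim_compose[OF filterlim_inverse_at_right_top filterlim_real_sequentially])
  have "((\<lambda>x. (p x - p 0) /\<^sub>R (x - 0) - (q x - q 0) /\<^sub>R (x - 0)) \<longlongrightarrow> s - s) (at_right 0)"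
    by (intro tendsto_diff has_vector_derivative_at_right_imp_tendsto p q)
  then have "((\<lambda>x. (p x - q x) /\<^sub>R x) \<longlongrightarrow> 0) (at_right 0)"
    by (simp add: p q flip: scaleR_diff_right)
  from tendsto_norm_zero[OF filterlim_compose[OF this at_right]]
  have lim: "(\<lambda>n. exp C * norm ((p (?x n) - q (?x n)) /\<^sub>R ?x n)) \<longlonglongrightarrow> 0"
    by (rule tendsto_mult_right_zero)
  have "\<forall>\<^sub>F x in at_right 0. norm (p x) \<le> 1 + C * x \<and> norm (q x) \<le> 1 + C * x"
    by (intro eventually_conj eventually_norm_le_one_plus[OF p] eventually_norm_le_one_plus[OF q])
      (simp_all add: C_def)
  from eventually_compose_filterlim[OF this at_right]
  have "\<forall>\<^sub>F n in sequentially. norm (p (?x n) ^ n - q (?x n) ^ n)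
      \<le> exp C * norm ((p (?x n) - q (?x n)) /\<^sub>R ?x n)"
    using eventually_gt_at_top[of 0]
  proof eventually_elim
    case (elim n)
    then show ?case
      using norm_power_diff_le_exp[of "p (?x n)" C n "q (?x n)"] by (simp add: C_def divide_inverse)
  qed
  then have diff: "(\<lambda>n. p (?x n) ^ n - q (?x n) ^ n) \<longlonglongrightarrow> 0"
    using lim by (rule Lim_null_comparison)
  have "\<forall>\<^sub>F n in sequentially. q (?x n) ^ n = exp s"
    using eventually_gt_at_top[of 0] by eventually_elim (simp add: q_def flip: exp_scaleR_of_nat)
  then have "(\<lambda>n. q (?x n) ^ n) \<longlonglongrightarrow> exp s"
    by (rule tendsto_eventually)
  then show ?thesis using diff by (rule Lim_transform)
qed

corollary exp_sum_list_product_formula: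
  fixes as :: "'a::{real_normed_algebra_1,banach} list"
  shows "(\<lambda>n. (\<Prod>a\<leftarrow>as. 1 + a /\<^sub>R real n) ^ n) \<longlonglongrightarrow> exp (sum_list as)"
proof (rule Chernoff_product_formula)
  show "(\<Prod>a\<leftarrow>as. 1 + 0 *\<^sub>R a) = 1"
    by (induction as) auto
  have "((\<lambda>x. \<Prod>a\<leftarrow>as. 1 + x *\<^sub>R a) has_vector_derivative sum_list as) (at 0)"
  proof (induction as)
    case (Cons a as)
    have "((\<lambda>x::real. 1 + x *\<^sub>R a) has_vector_derivative a) (at 0)"
      by (auto intro!: derivative_eq_intros)
    from has_vector_derivative_mult[OF this Cons] show ?case
      by (simp add: map_replicate_const add.commute)
  qed simp
  then show "((\<lambda>x. \<Prod>a\<leftarrow>as. 1 + x *\<^sub>R a) has_vector_derivative sum_list as) (at_right 0)"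
    by (rule has_vector_derivative_at_within)
qed

subsection \<open>Second-order bound for the logarithm of a holomorphic function\<close>

lemma Re_holomorphic_Taylor_Lagrange:
  assumes holo: "f holomorphic_on S" "open S" and seg: "closed_segment c w \<subseteq> S" and "0 < n"
  shows "\<exists>u\<in>closed_segment c w. Re (f w) =
    (\<Sum>m<n. Re ((deriv ^^ m) f c * (w - c) ^ m) / fact m)
    + Re ((deriv ^^ n) f u * (w - c) ^ n) / fact n"
proof -
  define u where "u = (\<lambda>t. c + of_real t * (w - c))"
  define D where "D = (\<lambda>m t. Re ((deriv ^^ m) f (u t) * (w - c) ^ m))"
  have u_seg: "u t \<in> closed_segment c w" if "0 \<le> t" "t \<le> 1" for t
    using that by (auto simp: u_def in_segment scaleR_conv_of_real algebra_simps)
  have "\<exists>t>0. t < 1 \<and> Re (f (u 1)) = (\<Sum>m<n. D m 0 / fact m * 1 ^ m) + D n t / fact n * 1 ^ n"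
  proof (rule Maclaurin)
    show "D 0 = (\<lambda>t. Re (f (u t)))" by (simp add: D_def)
    show "\<forall>m t. m < n \<and> 0 \<le> t \<and> t \<le> 1 \<longrightarrow> DERIV (D m) t :> D (Suc m) t"
    proof (intro allI impI, elim conjE)
      fix m t assume "(0::real) \<le> t" "t \<le> 1"
      then have "((deriv ^^ m) f has_field_derivative (deriv ^^ Suc m) f (u t)) (at (u t))"
        using u_seg seg by (intro has_field_derivative_higher_deriv[OF holo]) auto
      moreover have "(u has_vector_derivative w - c) (at t)"
        unfolding u_def by (auto intro!: derivative_eq_intros)
      ultimately have "((\<lambda>t. (deriv ^^ m) f (u t)) has_vector_derivative
          (w - c) * (deriv ^^ Suc m) f (u t)) (at t)"
        using field_vector_diff_chain_at by (fastforce simp: o_def)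
      from has_vector_derivative_mult_left[OF this, of "(w - c) ^ m"]
      have "((\<lambda>t. (deriv ^^ m) f (u t) * (w - c) ^ m) has_vector_derivative
          (deriv ^^ Suc m) f (u t) * (w - c) ^ Suc m) (at t)"
        by (simp only: power_Suc mult_ac)
      from bounded_linear.has_vector_derivative[OF bounded_linear_Re this]
      show "DERIV (D m) t :> D (Suc m) t"
        by (simp only: D_def has_real_derivative_iff_has_vector_derivative)
    qed
  qed (use \<open>0 < n\<close> in auto)
  then obtain t where "0 < t" "t < 1"
    and "Re (f (u 1)) = (\<Sum>m<n. D m 0 / fact m) + D n t / fact n" by auto
  then show ?thesis
    using u_seg[of t] by (auto simp: D_def u_def)
qed

lemma norm_deriv_le_on_ball:
  assumes holo: "f holomorphic_on ball c R" and bound: "\<And>z. z \<in> ball c R \<Longrightarrow> norm (f z) \<le> B"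
    and u: "u \<in> ball c R"
  shows "norm (deriv f u) \<le> B / (R - dist c u)"
proof -
  have deriv_bound: "norm (deriv f u) * r \<le> B" if r: "0 < r" "r < R - dist c u" for r
  proof -
    have sub: "cball u r \<subseteq> ball c R"
      using r by (simp add: cball_subset_ball_iff dist_commute)
    have "norm ((deriv ^^ 1) f u) \<le> fact 1 * B / r ^ 1"
    proof (rule Cauchy_inequality)
      show "f holomorphic_on ball u r" "continuous_on (cball u r) f"
        using sub holo
        by (meson ball_subset_cball holomorphic_on_imp_continuous_on holomorphic_on_subset
            order_trans)+
      show "norm (f x) \<le> B" if "norm (u - x) = r" for x
        using sub that by (intro bound) (auto simp: dist_norm)
    qed (rule r)
    then show ?thesis using r by (simp add: field_simps)
  qed
  have "norm (deriv f u) * (R - dist c u) \<le> B"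
  proof (rule field_le_mult_one_interval)
    fix x :: real
    assume "0 < x" "x < 1"
    then show "x * (norm (deriv f u) * (R - dist c u)) \<le> B"
      using deriv_bound[of "x * (R - dist c u)"] u by (simp add: mult.left_commute)
  qed
  then show ?thesis using u by (simp add: field_simps)
qed

lemma holomorphic_logarithm_deriv:
  assumes der: "\<And>z. z \<in> S \<Longrightarrow> (f has_field_derivative f' z) (at z)"
    and nz: "\<And>z. z \<in> S \<Longrightarrow> f z \<noteq> 0"
    and "convex S" "open S" "c \<in> S"
  obtains g where "g holomorphic_on S" "\<And>z. z \<in> S \<Longrightarrow> exp (g z) = f z"
    "\<And>z. z \<in> S \<Longrightarrow> deriv g z = f' z / f z"
proof -
  have "f holomorphic_on S"
    using der \<open>open S\<close> holomorphic_on_open by blast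
  then obtain g where holo: "g holomorphic_on S" and g: "\<And>z. z \<in> S \<Longrightarrow> exp (g z) = f z"
    using holomorphic_logarithm_exists[of S f c] assms by metis
  have "deriv g z = f' z / f z" if z: "z \<in> S" for z
  proof -
    have "((\<lambda>z. exp (g z)) has_field_derivative exp (g z) * deriv g z) (at z)"
      using holomorphic_derivI[OF holo \<open>open S\<close> z] by (auto intro!: derivative_eq_intros)
    then have "(f has_field_derivative f z * deriv g z) (at z)"
      using g z \<open>open S\<close> by (metis (no_types, lifting) has_field_derivative_transform_within_open)
    then show ?thesis
      using DERIV_unique[OF der[OF z]] nz[OF z] by simp
  qed
  then show ?thesis using holo g that by blast
qed

lemma ln_norm_le_second_order:
  fixes Z Z' :: "complex \<Rightarrow> complex"
  assumes der: "\<And>z. z \<in> ball c R \<Longrightarrow> (Z has_field_derivative Z' z) (at z)"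
    and nz: "\<And>z. z \<in> ball c R \<Longrightarrow> Z z \<noteq> 0"
    and bound: "\<And>z. z \<in> ball c R \<Longrightarrow> norm (Z' z) \<le> B * norm (Z z)"
    and w: "w \<in> ball c R"
  shows "ln (norm (Z w))
    \<le> ln (norm (Z c)) + Re (Z' c / Z c * (w - c)) + B / 2 * (dist c w)\<^sup>2 / (R - dist c w)"
proof -
  have c: "c \<in> ball c R"
    using w by (auto intro: le_less_trans[OF zero_le_dist])
  obtain g where holo: "g holomorphic_on ball c R"
    and exp_g: "\<And>z. z \<in> ball c R \<Longrightarrow> exp (g z) = Z z"
    and deriv_g: "\<And>z. z \<in> ball c R \<Longrightarrow> deriv g z = Z' z / Z z"
    using holomorphic_logarithm_deriv[OF der nz convex_ball open_ball c] by metis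
  have ln_Z: "ln (norm (Z z)) = Re (g z)" if "z \<in> ball c R" for z
    by (simp flip: exp_g[OF that])
  have deriv_bound: "norm (deriv g z) \<le> B" if "z \<in> ball c R" for z
    using bound[OF that] nz[OF that] by (simp add: deriv_g[OF that] norm_divide field_simps)
  then have "0 \<le> B" using c norm_ge_zero order_trans by blast
  have "closed_segment c w \<subseteq> ball c R"
    using c w by (simp add: closed_segment_subset)
  from Re_holomorphic_Taylor_Lagrange[OF holo open_ball this, of 2]
  obtain u where u: "u \<in> closed_segment c w" and taylor:
      "Re (g w) = Re (g c) + Re (deriv g c * (w - c)) + Re (deriv (deriv g) u * (w - c)\<^sup>2) / 2"
    by (auto simp: numeral_2_eq_2)
  have dist: "dist c u \<le> dist c w"
    using u by (metis dist_commute dist_in_closed_segment)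
  have "Re (deriv (deriv g) u * (w - c)\<^sup>2) \<le> norm (deriv (deriv g) u) * (dist c w)\<^sup>2"
    using complex_Re_le_cmod by (metis dist_commute dist_norm norm_mult norm_power)
  also have "\<dots> \<le> B / (R - dist c u) * (dist c w)\<^sup>2"
    using w dist deriv_bound
    by (intro mult_right_mono norm_deriv_le_on_ball holomorphic_deriv holo) auto
  also have "\<dots> \<le> B / (R - dist c w) * (dist c w)\<^sup>2"
    using w dist \<open>0 \<le> B\<close> by (intro mult_right_mono divide_left_mono) auto
  finally have "Re (deriv (deriv g) u * (w - c)\<^sup>2) / 2 \<le> B / (R - dist c w) * (dist c w)\<^sup>2 / 2"
    by (rule divide_right_mono) simp
  also have "\<dots> = B / 2 * (dist c w)\<^sup>2 / (R - dist c w)" by simp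
  finally show ?thesis
    unfolding ln_Z[OF w] ln_Z[OF c] taylor deriv_g[OF c] by (rule add_left_mono)
qed

subsection \<open>The operator norm\<close>

lemma norm_matrix_vector_le_op_norm: "norm (A *v x) \<le> op_norm A * norm x"
  for A :: "complex ^ 'n ^ 'n"
  unfolding op_norm_def by (rule onorm) simp

lemma op_norm_le:
  fixes A :: "complex ^ 'n ^ 'n"
  assumes "\<And>x. norm (A *v x) \<le> B * norm x"
  shows "op_norm A \<le> B"
  unfolding op_norm_def using assms by (rule onorm_le)

lemma op_norm_nonneg: "0 \<le> op_norm A" for A :: "complex ^ 'n ^ 'n"
  unfolding op_norm_def by (rule onorm_pos_le) simp

lemma norm_entry_le_op_norm: "norm (A $ i $ j) \<le> op_norm A" for A :: "complex ^ 'n ^ 'n"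
proof -
  have "norm (A $ i $ j) = norm ((A *v axis j 1) $ i)"
    by (simp add: axis_def matrix_vector_mult_def if_distrib cong: if_cong)
  also have "\<dots> \<le> norm (A *v axis j 1)"
    by (rule Finite_Cartesian_Product.norm_nth_le)
  also have "\<dots> \<le> op_norm A"
    using norm_matrix_vector_le_op_norm[of A "axis j 1"] by (simp add: norm_axis_1)
  finally show ?thesis .
qed

lemma op_norm_le_sum_entries: "op_norm A \<le> (\<Sum>i\<in>UNIV. \<Sum>j\<in>UNIV. norm (A $ i $ j))"
  for A :: "complex ^ 'n ^ 'n"
proof (rule op_norm_le)
  fix x :: "complex ^ 'n"
  have "norm (A *v x) \<le> (\<Sum>i\<in>UNIV. norm ((A *v x) $ i))"
    unfolding norm_vec_def by (rule L2_set_le_sum) simp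
  also have "\<dots> \<le> (\<Sum>i\<in>UNIV. \<Sum>j\<in>UNIV. norm (A $ i $ j) * norm x)"
    by (intro sum_mono) (auto simp: matrix_vector_mult_def norm_mult
        intro!: order_trans[OF norm_sum] sum_mono mult_left_mono
          Finite_Cartesian_Product.norm_nth_le)
  also have "\<dots> = (\<Sum>i\<in>UNIV. \<Sum>j\<in>UNIV. norm (A $ i $ j)) * norm x"
    by (simp add: sum_distrib_right)
  finally show "norm (A *v x) \<le> (\<Sum>i\<in>UNIV. \<Sum>j\<in>UNIV. norm (A $ i $ j)) * norm x" .
qed

lemma op_norm_mat: "op_norm (mat c :: complex ^ 'n ^ 'n) = norm c"
proof (rule antisym)
  have "mat c *v x = c *s x" for x :: "complex ^ 'n"
    by (simp add: vec_eq_iff mat_def matrix_vector_mult_def if_distrib if_distribR cong: if_cong)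
  moreover have "norm (c *s x) = norm c * norm x" for x :: "complex ^ 'n"
    by (simp add: norm_vec_def norm_mult L2_set_right_distrib)
  ultimately show "op_norm (mat c :: complex ^ 'n ^ 'n) \<le> norm c"
    by (intro op_norm_le) simp
  show "norm c \<le> op_norm (mat c :: complex ^ 'n ^ 'n)"
    using norm_entry_le_op_norm[of "mat c :: complex ^ 'n ^ 'n" undefined undefined]
    by (simp add: mat_def)
qed

lemma op_norm_eq_0_iff: "op_norm A = 0 \<longleftrightarrow> A = 0" for A :: "complex ^ 'n ^ 'n"
proof
  assume "op_norm A = 0"
  then have "norm (A $ i $ j) \<le> 0" for i j
    using norm_entry_le_op_norm[of A i j] by simp
  then show "A = 0" by (simp add: vec_eq_iff)
qed (use op_norm_mat[of 0, where 'n='n] in simp)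

lemma op_norm_add_le: "op_norm (A + B) \<le> op_norm A + op_norm B" for A B :: "complex ^ 'n ^ 'n"
  unfolding op_norm_def matrix_vector_mult_add_rdistrib by (rule onorm_triangle) simp_all

lemma op_norm_scaleR: "op_norm (r *\<^sub>R A) = \<bar>r\<bar> * op_norm A" for A :: "complex ^ 'n ^ 'n"
proof -
  have "(*v) (r *\<^sub>R A) = (\<lambda>x. r *\<^sub>R (A *v x))"
    by (auto simp: matrix_vector_mult_def vec_eq_iff scaleR_sum_right)
  then show ?thesis by (simp add: op_norm_def onorm_scaleR)
qed

lemma op_norm_mult_le: "op_norm (A ** B) \<le> op_norm A * op_norm B" for A B :: "complex ^ 'n ^ 'n"
proof (rule op_norm_le)
  fix x
  have "norm (A *v (B *v x)) \<le> op_norm A * norm (B *v x)"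
    by (rule norm_matrix_vector_le_op_norm)
  also have "\<dots> \<le> op_norm A * (op_norm B * norm x)"
    by (intro mult_left_mono norm_matrix_vector_le_op_norm op_norm_nonneg)
  finally show "norm (A ** B *v x) \<le> op_norm A * op_norm B * norm x"
    by (simp add: matrix_vector_mul_assoc mult.assoc)
qed

subsection \<open>The Banach algebra of complex matrices\<close>

text \<open>A copy of the matrix type: \<open>vec\<close> already carries the Euclidean norm, and \<open>exp\<close> needs the
  operator norm and the matrix product.\<close>
typedef 'n cmat = "UNIV :: (complex ^ ('n::finite) ^ 'n) set"
  morphisms matrix_of Cmat ..

setup_lifting type_definition_cmat

instantiation cmat :: (finite) real_algebra_1
begin

lift_definition zero_cmat :: "'a cmat" is 0 .
lift_definition one_cmat :: "'a cmat" is "mat 1" .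
lift_definition plus_cmat :: "'a cmat \<Rightarrow> 'a cmat \<Rightarrow> 'a cmat" is "(+)" .
lift_definition minus_cmat :: "'a cmat \<Rightarrow> 'a cmat \<Rightarrow> 'a cmat" is "(-)" .
lift_definition uminus_cmat :: "'a cmat \<Rightarrow> 'a cmat" is uminus .
lift_definition times_cmat :: "'a cmat \<Rightarrow> 'a cmat \<Rightarrow> 'a cmat" is "(**)" .
lift_definition scaleR_cmat :: "real \<Rightarrow> 'a cmat \<Rightarrow> 'a cmat" is "(*\<^sub>R)" .

instance
proof
  fix a b c :: "'a cmat" and r s :: real
  show "a + b + c = a + (b + c)" by transfer (simp add: add.assoc)
  show "a + b = b + a" by transfer (simp add: add.commute)
  show "0 + a = a" by transfer simp
  show "- a + a = 0" by transfer simp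
  show "a - b = a + - b" by transfer simp
  show "r *\<^sub>R (a + b) = r *\<^sub>R a + r *\<^sub>R b" by transfer (simp add: scaleR_right_distrib)
  show "(r + s) *\<^sub>R a = r *\<^sub>R a + s *\<^sub>R a" by transfer (simp add: scaleR_left_distrib)
  show "r *\<^sub>R s *\<^sub>R a = (r * s) *\<^sub>R a" by transfer simp
  show "1 *\<^sub>R a = a" by transfer simp
  show "a * b * c = a * (b * c)" by transfer (simp add: matrix_mul_assoc)
  show "(a + b) * c = a * c + b * c"
    by transfer (simp add: matrix_matrix_mult_def vec_eq_iff distrib_right sum.distrib)
  show "a * (b + c) = a * b + a * c" by transfer (simp add: matrix_add_ldistrib)
  show "r *\<^sub>R a * b = r *\<^sub>R (a * b)"
    by transfer (simp add: matrix_matrix_mult_def vec_eq_iff scaleR_sum_right)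
  show "a * r *\<^sub>R b = r *\<^sub>R (a * b)"
    by transfer (simp add: matrix_matrix_mult_def vec_eq_iff scaleR_sum_right)
  show "1 * a = a" by transfer simp
  show "a * 1 = a" by transfer simp
  show "(0::'a cmat) \<noteq> 1" by transfer (auto simp: vec_eq_iff mat_def)
qed

end

instantiation cmat :: (finite) real_normed_algebra_1
begin

lift_definition norm_cmat :: "'a cmat \<Rightarrow> real" is op_norm .

definition dist_cmat :: "'a cmat \<Rightarrow> 'a cmat \<Rightarrow> real"
  where "dist_cmat a b = norm (a - b)"
definition uniformity_cmat :: "('a cmat \<times> 'a cmat) filter"
  where "uniformity_cmat = (INF e\<in>{0 <..}. principal {(x, y). dist x y < e})"
definition open_cmat :: "'a cmat set \<Rightarrow> bool"
  where "open_cmat U \<longleftrightarrow> (\<forall>x\<in>U. \<forall>\<^sub>F (x', y) in uniformity. x' = x \<longrightarrow> y \<in> U)"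
definition sgn_cmat :: "'a cmat \<Rightarrow> 'a cmat"
  where "sgn_cmat a = a /\<^sub>R norm a"

instance
proof
  fix a b :: "'a cmat" and r :: real
  show "norm a = 0 \<longleftrightarrow> a = 0" by transfer (rule op_norm_eq_0_iff)
  show "norm (a + b) \<le> norm a + norm b" by transfer (rule op_norm_add_le)
  show "norm (r *\<^sub>R a) = \<bar>r\<bar> * norm a" by transfer (rule op_norm_scaleR)
  show "norm (a * b) \<le> norm a * norm b" by transfer (rule op_norm_mult_le)
  show "norm (1 :: 'a cmat) = 1" by transfer (simp add: op_norm_mat)
qed (rule dist_cmat_def sgn_cmat_def uniformity_cmat_def open_cmat_def)+

end

definition entry :: "'n::finite \<Rightarrow> 'n \<Rightarrow> 'n cmat \<Rightarrow> complex"
  where "entry i j a = matrix_of a $ i $ j"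

lemma cmat_eqI: "(\<And>i j. entry i j a = entry i j b) \<Longrightarrow> a = b"
  by (simp add: entry_def vec_eq_iff flip: matrix_of_inject)

lemma entry_Cmat: "entry i j (Cmat A) = A $ i $ j"
  by (simp add: entry_def Cmat_inverse)

lemma entry_one: "entry i j 1 = (if i = j then 1 else 0)"
  by (simp add: entry_def one_cmat.rep_eq mat_def)

lemma entry_mult: "entry i j (a * b) = (\<Sum>l\<in>UNIV. entry i l a * entry l j b)"
  by (simp add: entry_def times_cmat.rep_eq matrix_matrix_mult_def)

lemma norm_entry_le: "norm (entry i j a) \<le> norm a"
  by (simp add: entry_def norm_cmat.rep_eq norm_entry_le_op_norm)

lemma norm_le_sum_entries: "norm a \<le> (\<Sum>i\<in>UNIV. \<Sum>j\<in>UNIV. norm (entry i j a))"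
  by (simp add: entry_def norm_cmat.rep_eq op_norm_le_sum_entries)

lemma bounded_linear_entry: "bounded_linear (entry i j)"
  by (rule bounded_linear_intro[where K = 1])
    (simp_all add: norm_entry_le, simp_all add: entry_def plus_cmat.rep_eq scaleR_cmat.rep_eq)

lemmas linear_entry = bounded_linear.linear[OF bounded_linear_entry]
lemmas entry_zero = linear_0[OF linear_entry]
lemmas entry_add = linear_add[OF linear_entry]
lemmas entry_diff = linear_diff[OF linear_entry]
lemmas entry_scaleR = linear_scale[OF linear_entry]
lemmas entry_sum = linear_sum[OF linear_entry]

lemma tendsto_cmatI:
  assumes "\<And>i j. ((\<lambda>x. entry i j (f x)) \<longlongrightarrow> entry i j l) F"
  shows "(f \<longlongrightarrow> l) F"
proof (rule Lim_null[THEN iffD2], rule Lim_null_comparison)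
  show "\<forall>\<^sub>F x in F. norm (f x - l) \<le> (\<Sum>i\<in>UNIV. \<Sum>j\<in>UNIV. norm (entry i j (f x) - entry i j l))"
    using norm_le_sum_entries by (auto simp flip: entry_diff intro!: always_eventually)
  show "((\<lambda>x. \<Sum>i\<in>UNIV. \<Sum>j\<in>UNIV. norm (entry i j (f x) - entry i j l)) \<longlongrightarrow> 0) F"
    using assms by (intro tendsto_null_sum tendsto_norm_zero LIM_zero)
qed

instance cmat :: (finite) banach
proof
  fix f :: "nat \<Rightarrow> 'a cmat"
  assume "Cauchy f"
  then have "convergent (\<lambda>n. entry i j (f n))" for i j
    by (intro Cauchy_convergent bounded_linear.Cauchy[OF bounded_linear_entry])
  then obtain l where l: "\<And>i j. (\<lambda>n. entry i j (f n)) \<longlonglongrightarrow> l i j"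
    unfolding convergent_def by metis
  have "f \<longlonglongrightarrow> Cmat (\<chi> i j. l i j)"
    by (rule tendsto_cmatI) (simp add: entry_Cmat l)
  then show "convergent f" by (rule convergentI)
qed

lemma matrix_of_power: "matrix_of (a ^ m) = mat_pow (matrix_of a) m"
  by (induction m) (simp_all add: one_cmat.rep_eq times_cmat.rep_eq)

lemma matrix_of_sum: "matrix_of (\<Sum>x\<in>S. a x) = (\<Sum>x\<in>S. matrix_of (a x))"
  by (induction S rule: infinite_finite_induct) (simp_all add: zero_cmat.rep_eq plus_cmat.rep_eq)

lemma entry_exp_sums: "(\<lambda>m. entry i j (a ^ m) /\<^sub>R fact m) sums entry i j (exp a)"
  using bounded_linear.sums[OF bounded_linear_entry exp_converges] by (simp add: entry_scaleR)

lemma matrix_of_exp: "matrix_of (exp a) = mat_exp (matrix_of a)"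
proof -
  have "(\<lambda>m. (1 / fact m) *\<^sub>R mat_pow (matrix_of a) m) sums matrix_of (exp a)"
    unfolding sums_def
  proof (intro vec_tendstoI)
    fix i j
    show "(\<lambda>n. (\<Sum>m<n. (1 / fact m) *\<^sub>R mat_pow (matrix_of a) m) $ i $ j)
        \<longlonglongrightarrow> matrix_of (exp a) $ i $ j"
      using entry_exp_sums[of i j a]
      by (simp add: sums_def entry_def matrix_of_power inverse_eq_divide)
  qed
  then show ?thesis
    unfolding mat_exp_def by (rule sums_unique)
qed

subsection \<open>Complex scaling and the normalised trace\<close>

definition cscale :: "complex \<Rightarrow> 'n::finite cmat \<Rightarrow> 'n cmat"
  where "cscale z a = Cmat (mat z) * a"

lemma entry_cscale: "entry i j (cscale z a) = z * entry i j a"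
  unfolding cscale_def entry_mult
  by (simp add: entry_Cmat mat_def if_distrib if_distribR cong: if_cong)

lemma cscale_of_real: "cscale (of_real r) a = r *\<^sub>R a"
  by (rule cmat_eqI) (simp add: entry_cscale entry_scaleR scaleR_conv_of_real[where 'a=complex])

lemma cscale_mult_left: "cscale z a * b = cscale z (a * b)"
  by (simp add: cscale_def mult.assoc)

lemma cscale_mult_right: "a * cscale z b = cscale z (a * b)"
  by (rule cmat_eqI) (simp add: entry_cscale entry_mult sum_distrib_left mult_ac)

lemma cscale_power: "cscale z a ^ m = cscale (z ^ m) (a ^ m)"
proof (induction m)
  case 0
  show ?case using cscale_of_real[of 1 1] by simp
next
  case (Suc m)
  then show ?case
    by (intro cmat_eqI) (simp add: cscale_mult_left cscale_mult_right entry_cscale)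
qed

lemma norm_cscale_le: "norm (cscale z a) \<le> norm z * norm a"
  unfolding cscale_def using norm_mult_ineq[of "Cmat (mat z)" a]
  by (simp add: norm_cmat.rep_eq Cmat_inverse op_norm_mat)

definition ntrace :: "'n::finite cmat \<Rightarrow> complex"
  where "ntrace a = trace (matrix_of a) / of_nat CARD('n)"

lemma ntrace_conv_entry: "ntrace a = (\<Sum>i\<in>UNIV. entry i i a) / of_nat CARD('n)"
  for a :: "'n::finite cmat"
  by (simp add: ntrace_def trace_def entry_def)

lemma ntrace_one: "ntrace 1 = 1"
  by (simp add: ntrace_conv_entry entry_one)

lemma ntrace_cscale: "ntrace (cscale z a) = z * ntrace a"
  by (simp add: ntrace_conv_entry entry_cscale sum_distrib_left)

lemma ntrace_mult_commute: "ntrace (a * b) = ntrace (b * a)"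
  by (simp add: ntrace_def times_cmat.rep_eq trace_mul_sym[of "matrix_of a"])

lemma norm_ntrace_le: "norm (ntrace a) \<le> norm a" for a :: "'n::finite cmat"
proof -
  have "norm (\<Sum>i\<in>(UNIV::'n set). entry i i a) \<le> of_nat CARD('n) * norm a"
    by (intro sum_norm_bound norm_entry_le)
  then show ?thesis
    by (simp add: ntrace_conv_entry norm_divide field_simps)
qed

lemma bounded_linear_ntrace: "bounded_linear (ntrace :: 'n::finite cmat \<Rightarrow> complex)"
proof (rule bounded_linear_intro[where K = 1])
  show "ntrace (a + b) = ntrace a + ntrace b" for a b :: "'n cmat"
    by (simp add: ntrace_conv_entry entry_add sum.distrib add_divide_distrib)
  show "ntrace (r *\<^sub>R a) = r *\<^sub>R ntrace a" for r and a :: "'n cmat"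
    using ntrace_cscale[of "of_real r" a] by (simp add: cscale_of_real scaleR_conv_of_real)
qed (simp add: norm_ntrace_le)

lemmas linear_ntrace = bounded_linear.linear[OF bounded_linear_ntrace]
lemmas ntrace_add = linear_add[OF linear_ntrace]
lemmas ntrace_scaleR = linear_scale[OF linear_ntrace]

lemma ntrace_mult_exp_cscale_sums:
  "(\<lambda>m. ntrace (b * a ^ m * c) / fact m * z ^ m) sums ntrace (b * exp (cscale z a) * c)"
proof -
  have "bounded_linear (\<lambda>x. ntrace (b * x * c))"
    by (intro bounded_linear_compose[OF bounded_linear_ntrace]
        bounded_linear_mult_const bounded_linear_const_mult bounded_linear_ident)
  then have "(\<lambda>m. ntrace (b * (cscale z a ^ m /\<^sub>R fact m) * c))
      sums ntrace (b * exp (cscale z a) * c)"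
    by (rule bounded_linear.sums[OF _ exp_converges])
  then show ?thesis
    by (simp add: cscale_power cscale_mult_left cscale_mult_right ntrace_scaleR ntrace_cscale
        scaleR_conv_of_real[where 'a=complex] divide_inverse mult_ac)
qed

lemma has_field_derivative_ntrace_exp_cscale:
  "((\<lambda>z. ntrace (exp (cscale z a) * c)) has_field_derivative
    ntrace (a * exp (cscale z a) * c)) (at z)"
proof -
  define u where "u m = ntrace (a ^ m * c) / fact m" for m
  have u_sums: "(\<lambda>m. u m * z ^ m) sums ntrace (exp (cscale z a) * c)" for z
    using ntrace_mult_exp_cscale_sums[of 1] by (simp add: u_def)
  have "diffs u m = ntrace (a * a ^ m * c) / fact m" for m
    by (simp add: diffs_def u_def mult.assoc del: of_nat_Suc)
  then have diffs_sums: "(\<lambda>m. diffs u m * z ^ m) sums ntrace (a * exp (cscale z a) * c)"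
    using ntrace_mult_exp_cscale_sums[of a] by simp
  have "((\<lambda>z. \<Sum>m. u m * z ^ m) has_field_derivative (\<Sum>m. diffs u m * z ^ m)) (at z)"
    using u_sums by (intro termdiffs_strong_converges_everywhere) (rule sums_summable)
  then show ?thesis
    using sums_unique[OF u_sums] sums_unique[OF diffs_sums] by simp
qed

subsection \<open>Hermitian matrices\<close>

definition hermitian_cmat :: "'n::finite cmat \<Rightarrow> bool"
  where "hermitian_cmat a \<longleftrightarrow> hermitian (matrix_of a)"

lemma hermitian_cmat_iff: "hermitian_cmat a \<longleftrightarrow> (\<forall>i j. cnj (entry i j a) = entry j i a)"
  unfolding hermitian_cmat_def hermitian_def entry_def by metis

lemma cnj_entry_hermitian_mult:
  assumes "hermitian_cmat a" "hermitian_cmat b"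
  shows "cnj (entry i j (a * b)) = entry j i (b * a)"
  using assms by (simp add: hermitian_cmat_iff entry_mult cnj_sum mult.commute)

lemma hermitian_cmat_power:
  assumes "hermitian_cmat a"
  shows "hermitian_cmat (a ^ m)"
proof (induction m)
  case 0
  show ?case by (simp add: hermitian_cmat_iff entry_one)
next
  case (Suc m)
  then show ?case
    unfolding hermitian_cmat_iff[of "a ^ Suc m"]
    using cnj_entry_hermitian_mult[OF assms Suc] by (simp add: power_commutes)
qed

lemma hermitian_cmat_exp:
  assumes "hermitian_cmat a"
  shows "hermitian_cmat (exp a)"
  unfolding hermitian_cmat_iff
proof (intro allI)
  fix i j
  have "(\<lambda>m. cnj (entry i j (a ^ m) /\<^sub>R fact m)) sums cnj (entry i j (exp a))"
    by (rule bounded_linear.sums[OF bounded_linear_cnj entry_exp_sums])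
  moreover have "cnj (entry i j (a ^ m)) = entry j i (a ^ m)" for m
    using hermitian_cmat_power[OF assms] by (simp add: hermitian_cmat_iff)
  ultimately show "cnj (entry i j (exp a)) = entry j i (exp a)"
    using entry_exp_sums[of j i a] by (simp add: sums_unique2)
qed

lemma hermitian_cmat_scaleR: "hermitian_cmat a \<Longrightarrow> hermitian_cmat (r *\<^sub>R a)"
  by (simp add: hermitian_cmat_iff entry_scaleR)

lemma hermitian_cmat_sum:
  "(\<And>x. x \<in> S \<Longrightarrow> hermitian_cmat (a x)) \<Longrightarrow> hermitian_cmat (\<Sum>x\<in>S. a x)"
  by (simp add: hermitian_cmat_iff entry_sum cnj_sum)

lemma ntrace_exp_mult_exp_pos:
  fixes a b :: "'n::finite cmat"
  assumes "hermitian_cmat a" "hermitian_cmat b"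
  obtains r where "0 < r" "ntrace (exp a * exp b) = complex_of_real r"
proof -
  define p where "p = exp (a /\<^sub>R 2)"
  define q where "q = exp (b /\<^sub>R 2)"
  have herm: "hermitian_cmat p" "hermitian_cmat q"
    unfolding p_def q_def using assms by (auto intro: hermitian_cmat_exp hermitian_cmat_scaleR)
  have half: "exp (x /\<^sub>R 2) * exp (x /\<^sub>R 2) = exp x" for x :: "'n cmat"
    using exp_add_commuting[of "x /\<^sub>R 2" "x /\<^sub>R 2"] by (simp flip: scaleR_add_left)
  have square: "p * p = exp a" "q * q = exp b"
    unfolding p_def q_def by (rule half)+
  have "q * p * (exp (- (a /\<^sub>R 2)) * exp (- (b /\<^sub>R 2)))
      = q * (p * exp (- (a /\<^sub>R 2))) * exp (- (b /\<^sub>R 2))"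
    by (simp add: mult.assoc)
  also have "\<dots> = 1"
    unfolding p_def q_def by (simp only: exp_minus_inverse mult_1_right)
  finally have "q * p \<noteq> 0" by auto
  then obtain i j where ij: "entry i j (q * p) \<noteq> 0"
    using cmat_eqI[of "q * p" 0] by (auto simp: entry_zero)
  \<comment> \<open>The trace is the squared Hilbert-Schmidt norm of \<open>q p\<close>, the product of the square roots.\<close>
  have "ntrace (exp a * exp b) = ntrace (p * (p * q * q))"
    by (simp add: mult.assoc flip: square)
  also have "\<dots> = ntrace ((p * q) * (q * p))"
    by (subst ntrace_mult_commute) (simp add: mult.assoc)
  also have "\<dots>
      = (\<Sum>i\<in>UNIV. \<Sum>j\<in>UNIV. cnj (entry j i (q * p)) * entry j i (q * p)) / of_nat CARD('n)"
    unfolding cnj_entry_hermitian_mult[OF herm(2,1)]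
    by (simp only: ntrace_conv_entry entry_mult[of _ _ "p * q"])
  also have "\<dots> = complex_of_real ((\<Sum>i\<in>UNIV. \<Sum>j\<in>UNIV. (norm (entry j i (q * p)))\<^sup>2) / CARD('n))"
    by (simp only: of_real_divide of_real_sum of_real_of_nat_eq complex_norm_square mult.commute)
  finally show ?thesis
  proof (rule that[rotated])
    have "0 < (\<Sum>i\<in>UNIV. \<Sum>j\<in>UNIV. (norm (entry j i (q * p)))\<^sup>2)"
      using ij by (intro sum_pos2[where i = j] sum_pos2[where i = i] sum_nonneg) auto
    then show "0 < (\<Sum>i\<in>UNIV. \<Sum>j\<in>UNIV. (norm (entry j i (q * p)))\<^sup>2) / CARD('n)" by simp
  qed
qed

subsection \<open>Supports\<close>

definition agree_on :: "'v set \<Rightarrow> ('v \<Rightarrow> 'q) \<Rightarrow> ('v \<Rightarrow> 'q) \<Rightarrow> bool"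
  where "agree_on X s t \<longleftrightarrow> (\<forall>v\<in>X. s v = t v)"

definition supported :: "'v::finite set \<Rightarrow> ('v \<Rightarrow> 'q::finite) cmat \<Rightarrow> bool"
  where "supported X a \<longleftrightarrow> supported_on X (matrix_of a)"

lemma supported_imp_agree:
  assumes "supported X a" "entry s t a \<noteq> 0"
  shows "agree_on (- X) s t"
  using assms unfolding supported_def supported_on_def entry_def agree_on_def
  by (metis ComplD)

lemma supported_entry_cong:
  assumes "supported X a"
    and "agree_on (- X) s t" "agree_on (- X) s' t'" "agree_on X s s'" "agree_on X t t'"
  shows "entry s t a = entry s' t' a"
proof -
  obtain c where c: "\<forall>s t s' t'. (\<forall>v\<in>X. s v = s' v \<and> t v = t' v) \<longrightarrow> c s t = c s' t'"
    and entry: "\<forall>s t. entry s t a = (if \<forall>v. v \<notin> X \<longrightarrow> s v = t v then c s t else 0)"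
    using assms(1) unfolding supported_def supported_on_def entry_def by (elim exE conjE)
  have "c s t = c s' t'"
    using assms(4,5) by (intro c[rule_format]) (simp add: agree_on_def)
  then show ?thesis
    using assms(2,3) entry by (simp add: agree_on_def)
qed

lemma supportedI:
  assumes off: "\<And>s t. entry s t a \<noteq> 0 \<Longrightarrow> agree_on (- X) s t"
    and cong: "\<And>s t s' t'. agree_on (- X) s t \<Longrightarrow> agree_on (- X) s' t' \<Longrightarrow>
      agree_on X s s' \<Longrightarrow> agree_on X t t' \<Longrightarrow> entry s t a = entry s' t' a"
  shows "supported X a"
proof -
  define c where "c s t = entry (override_on undefined s X) (override_on undefined t X) a" for s t
  have "c s t = c s' t'" if "\<forall>v\<in>X. s v = s' v \<and> t v = t' v" for s t s' t'
  proof -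
    have "override_on undefined s X = override_on undefined s' X"
      "override_on undefined t X = override_on undefined t' X"
      using that by (auto simp: override_on_def)
    then show ?thesis by (simp add: c_def)
  qed
  moreover have "entry s t a = (if \<forall>v. v \<notin> X \<longrightarrow> s v = t v then c s t else 0)" for s t
  proof (cases "\<forall>v. v \<notin> X \<longrightarrow> s v = t v")
    case True
    then show ?thesis
      unfolding c_def by (auto simp: agree_on_def override_on_def intro!: cong)
  qed (use off[of s t] in \<open>auto simp: agree_on_def\<close>)
  ultimately show ?thesis
    unfolding supported_def supported_on_def entry_def by blast
qed

lemma supported_mono:
  assumes a: "supported X a" and "X \<subseteq> Y"
  shows "supported Y a"
proof (rule supportedI)
  fix s t
  assume "entry s t a \<noteq> 0"
  then show "agree_on (- Y) s t"
    using supported_imp_agree[OF a] \<open>X \<subseteq> Y\<close> by (auto simp: agree_on_def)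
next
  fix s t s' t' :: "'a \<Rightarrow> 'b"
  assume off: "agree_on (- Y) s t" "agree_on (- Y) s' t'"
    and on: "agree_on Y s s'" "agree_on Y t t'"
  have iff: "agree_on (- X) s t \<longleftrightarrow> agree_on (- X) s' t'"
    using off on unfolding agree_on_def by (metis ComplI)
  show "entry s t a = entry s' t' a"
  proof (cases "agree_on (- X) s t")
    case True
    then show ?thesis
      using iff on \<open>X \<subseteq> Y\<close> by (intro supported_entry_cong[OF a]) (auto simp: agree_on_def)
  next
    case False
    then show ?thesis
      using iff supported_imp_agree[OF a] by metis
  qed
qed

lemma supported_one: "supported X 1"
proof (rule supportedI)
  fix s t s' t' :: "'a \<Rightarrow> 'b"
  assume "agree_on (- X) s t" "agree_on (- X) s' t'" "agree_on X s s'" "agree_on X t t'"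
  then have "s = t \<longleftrightarrow> s' = t'"
    unfolding agree_on_def fun_eq_iff by (metis ComplI)
  then show "entry s t 1 = entry s' t' 1" by (simp add: entry_one)
qed (simp add: entry_one agree_on_def split: if_splits)

lemma supported_UNIV: "supported UNIV a"
proof (rule supportedI)
  fix s t s' t' :: "'a \<Rightarrow> 'b"
  assume "agree_on UNIV s s'" "agree_on UNIV t t'"
  then have "s = s'" "t = t'" by (auto simp: agree_on_def)
  then show "entry s t a = entry s' t' a" by simp
qed (simp add: agree_on_def)

lemma supported_add:
  assumes a: "supported X a" and b: "supported X b"
  shows "supported X (a + b)"
proof (rule supportedI)
  fix s t
  assume "entry s t (a + b) \<noteq> 0"
  then have "entry s t a \<noteq> 0 \<or> entry s t b \<noteq> 0" by (auto simp: entry_add)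
  then show "agree_on (- X) s t"
    using supported_imp_agree a b by blast
qed (simp add: entry_add supported_entry_cong[OF a] supported_entry_cong[OF b])

lemma supported_cscale:
  assumes "supported X a"
  shows "supported X (cscale z a)"
proof (rule supportedI)
  fix s t
  assume "entry s t (cscale z a) \<noteq> 0"
  then show "agree_on (- X) s t"
    using supported_imp_agree[OF assms] by (simp add: entry_cscale)
qed (simp add: entry_cscale supported_entry_cong[OF assms])

lemma supported_mult:
  assumes a: "supported X a" and b: "supported X b"
  shows "supported X (a * b)"
proof (rule supportedI)
  fix s t
  assume "entry s t (a * b) \<noteq> 0"
  then obtain u where "entry s u a * entry u t b \<noteq> 0"
    unfolding entry_mult by (meson sum.not_neutral_contains_not_neutral)
  then have "agree_on (- X) s u" "agree_on (- X) u t"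
    using supported_imp_agree a b by auto
  then show "agree_on (- X) s t"
    by (simp add: agree_on_def)
next
  fix s t s' t' :: "'a \<Rightarrow> 'b"
  assume off: "agree_on (- X) s t" "agree_on (- X) s' t'"
    and on: "agree_on X s s'" "agree_on X t t'"
  have restrict: "entry p q (a * b) = (\<Sum>u | agree_on (- X) p u. entry p u a * entry u q b)" for p q
    unfolding entry_mult
  proof (rule sum.mono_neutral_right)
    have "entry p u a = 0" if "\<not> agree_on (- X) p u" for u
      using that supported_imp_agree[OF a] by blast
    then show "\<forall>u\<in>UNIV - {u. agree_on (- X) p u}. entry p u a * entry u q b = 0" by simp
  qed simp_all
  show "entry s t (a * b) = entry s' t' (a * b)"
    unfolding restrict
  proof (rule sum.reindex_bij_witness[where
        j = "\<lambda>u. override_on s' u X" and i = "\<lambda>u. override_on s u X"])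
    fix u
    assume u: "u \<in> {u. agree_on (- X) s u}"
    let ?u' = "override_on s' u X"
    have "entry s u a = entry s' ?u' a"
      using u on by (intro supported_entry_cong[OF a]) (auto simp: agree_on_def override_on_def)
    moreover have "entry u t b = entry ?u' t' b"
      using u off on by (intro supported_entry_cong[OF b]) (auto simp: agree_on_def override_on_def)
    ultimately show "entry s' ?u' a * entry ?u' t' b = entry s u a * entry u t b" by simp
  qed (auto simp: agree_on_def override_on_def fun_eq_iff)
qed

lemma supported_prod_list: "(\<And>a. a \<in> set as \<Longrightarrow> supported X a) \<Longrightarrow> supported X (prod_list as)"
  by (induction as) (auto intro: supported_one supported_mult)

lemma entry_mult_disjoint_supported:
  assumes a: "supported X a" and b: "supported Y b" and disj: "X \<inter> Y = {}"
  shows "entry s t (a * b) = entry s (override_on s t X) a * entry (override_on s t X) t b"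
proof -
  have "entry s u a * entry u t b = 0" if "u \<noteq> override_on s t X" for u
  proof (rule ccontr)
    assume "entry s u a * entry u t b \<noteq> 0"
    then have "agree_on (- X) s u" "agree_on (- Y) u t"
      using supported_imp_agree a b by auto
    then have "u = override_on s t X"
      using disj by (auto simp: agree_on_def override_on_def fun_eq_iff)
    with that show False by simp
  qed
  then show ?thesis
    unfolding entry_mult
    by (subst sum.mono_neutral_right[of _ "{override_on s t X}"]) auto
qed

lemma disjoint_supported_commute:
  fixes a b :: "('v::finite \<Rightarrow> 'q::finite) cmat"
  assumes a: "supported X a" and b: "supported Y b" and disj: "X \<inter> Y = {}"
  shows "a * b = b * a"
proof (rule cmat_eqI)
  fix s t :: "'v \<Rightarrow> 'q"
  let ?x = "override_on s t X" and ?y = "override_on s t Y"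
  have ab: "entry s t (a * b) = entry s ?x a * entry ?x t b"
    by (rule entry_mult_disjoint_supported[OF a b disj])
  have ba: "entry s t (b * a) = entry s ?y b * entry ?y t a"
    by (rule entry_mult_disjoint_supported[OF b a]) (use disj in auto)
  show "entry s t (a * b) = entry s t (b * a)"
  proof (cases "agree_on (- (X \<union> Y)) s t")
    case True
    have "entry s ?x a = entry ?y t a"
      using True disj
      by (intro supported_entry_cong[OF a]) (auto simp: agree_on_def override_on_def)
    moreover have "entry ?x t b = entry s ?y b"
      using True disj
      by (intro supported_entry_cong[OF b]) (auto simp: agree_on_def override_on_def)
    ultimately show ?thesis by (simp add: ab ba)
  next
    case False
    then have "\<not> agree_on (- Y) ?x t" "\<not> agree_on (- X) ?y t"
      by (auto simp: agree_on_def override_on_def)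
    then have "entry ?x t b = 0" "entry ?y t a = 0"
      using supported_imp_agree a b by blast+
    then show ?thesis by (simp add: ab ba)
  qed
qed

lemma ntrace_mult_disjoint_supported:
  fixes a b :: "('v::finite \<Rightarrow> 'q::finite) cmat"
  assumes a: "supported X a" and b: "supported Y b" and disj: "X \<inter> Y = {}"
  shows "ntrace (a * b) = ntrace a * ntrace b"
proof -
  let ?U = "UNIV :: ('v \<Rightarrow> 'q) set"
  let ?swap = "\<lambda>(s, r). (override_on r s X, override_on s r X)"
  have diag: "entry s s (a * b) = entry s s a * entry s s b" for s
    using entry_mult_disjoint_supported[OF a b disj, of s s] by (simp add: override_on_def)
  have "(\<Sum>s\<in>?U. entry s s a) * (\<Sum>r\<in>?U. entry r r b)
      = (\<Sum>(s, r)\<in>?U \<times> ?U. entry s s a * entry r r b)"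
    by (simp add: sum_product sum.cartesian_product)
  also have "\<dots> = (\<Sum>(s, r)\<in>?U \<times> ?U. entry s s a * entry s s b)"
  proof (rule sum.reindex_bij_witness[where i = ?swap and j = ?swap])
    fix p :: "('v \<Rightarrow> 'q) \<times> ('v \<Rightarrow> 'q)"
    obtain s r where p: "p = (s, r)" by fastforce
    let ?o = "override_on r s X"
    have "entry ?o ?o a = entry s s a"
      by (intro supported_entry_cong[OF a]) (auto simp: agree_on_def override_on_def)
    moreover have "entry ?o ?o b = entry r r b"
      using disj by (intro supported_entry_cong[OF b]) (auto simp: agree_on_def override_on_def)
    ultimately show "(case ?swap p of (s, r) \<Rightarrow> entry s s a * entry s s b)
        = (case p of (s, r) \<Rightarrow> entry s s a * entry r r b)"
      by (simp add: p)
  qed (auto simp: override_on_def fun_eq_iff)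
  also have "\<dots> = of_nat CARD('v \<Rightarrow> 'q) * (\<Sum>s\<in>?U. entry s s a * entry s s b)"
    unfolding sum.cartesian_product[symmetric] by (simp add: sum_distrib_left)
  finally show ?thesis
    by (simp add: ntrace_conv_entry diag field_simps)
qed

subsection \<open>Local terms\<close>

definition site_norm :: "('v set \<times> 'a::real_normed_vector) list \<Rightarrow> 'v \<Rightarrow> real"
  where "site_norm ts v = (\<Sum>(X, a)\<leftarrow>ts. if v \<in> X then norm a else 0)"

lemma site_norm_simps [simp]:
  "site_norm [] v = 0"
  "site_norm ((X, a) # ts) v = (if v \<in> X then norm a else 0) + site_norm ts v"
  "site_norm (ts @ us) v = site_norm ts v + site_norm us v"
  by (simp_all add: site_norm_def)

lemma site_norm_nonneg: "0 \<le> site_norm ts v"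
  by (induction ts) auto

definition overlap_norm :: "'v set \<Rightarrow> ('v set \<times> 'a::real_normed_vector) list \<Rightarrow> real"
  where "overlap_norm S ts = (\<Sum>v\<in>S. site_norm ts v)"

lemma overlap_norm_nonneg: "0 \<le> overlap_norm S ts"
  by (simp add: overlap_norm_def sum_nonneg site_norm_nonneg)

lemma overlap_norm_Un_le: "overlap_norm (S \<union> T) ts \<le> overlap_norm S ts + overlap_norm T ts"
  for S T :: "'v::finite set"
  by (simp add: overlap_norm_def sum_Un sum_nonneg site_norm_nonneg)

lemma overlap_norm_insert_ge:
  fixes S :: "'v::finite set"
  assumes "X \<inter> S \<noteq> {}"
  shows "norm a + overlap_norm S (ts @ us) \<le> overlap_norm S (ts @ (X, a) # us)"
proof -
  obtain v where "v \<in> S" "v \<in> X" using assms by blast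
  then have "norm a \<le> (\<Sum>v\<in>S. if v \<in> X then norm a else 0)"
    using member_le_sum[of v S "\<lambda>v. if v \<in> X then norm a else 0"] by simp
  then show ?thesis by (simp add: overlap_norm_def sum.distrib)
qed

definition local_terms :: "nat \<Rightarrow> real \<Rightarrow> ('v::finite set \<times> ('v \<Rightarrow> 'q::finite) cmat) list \<Rightarrow> bool"
  where "local_terms k \<eta> ts \<longleftrightarrow>
    (\<forall>(X, a)\<in>set ts. supported X a \<and> card X \<le> k) \<and> (\<forall>v. site_norm ts v \<le> \<eta>)"

lemma local_termsD:
  assumes "local_terms k \<eta> ts" "(X, a) \<in> set ts"
  shows "supported X a" "card X \<le> k"
  using assms by (auto simp: local_terms_def)

lemma local_terms_nonneg: "local_terms k \<eta> ts \<Longrightarrow> 0 \<le> \<eta>"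
  unfolding local_terms_def by (meson site_norm_nonneg order_trans)

lemma local_terms_delete:
  assumes "local_terms k \<eta> (ts @ t # us)"
  shows "local_terms k \<eta> (ts @ us)"
proof -
  have "site_norm (ts @ us) v \<le> site_norm (ts @ t # us) v" for v
    by (cases t) simp
  then have "site_norm (ts @ us) v \<le> \<eta>" for v
    using assms unfolding local_terms_def by (meson order_trans)
  then show ?thesis
    using assms unfolding local_terms_def by simp
qed

lemma local_terms_append:
  "local_terms k \<eta> ts \<Longrightarrow> local_terms k \<theta> us \<Longrightarrow> local_terms k (\<eta> + \<theta>) (ts @ us)"
  by (auto simp: local_terms_def add_mono)

lemma overlap_norm_le_card:
  fixes \<eta> :: real
  assumes "local_terms k \<eta> ts"
  shows "overlap_norm S ts \<le> card S * \<eta>"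
  unfolding overlap_norm_def using assms by (intro sum_bounded_above) (simp add: local_terms_def)

lemma overlap_norm_le:
  fixes \<eta> :: real
  assumes "local_terms k \<eta> ts" "card S \<le> k"
  shows "overlap_norm S ts \<le> k * \<eta>"
  using overlap_norm_le_card[OF assms(1)] local_terms_nonneg[OF assms(1)] assms(2)
  by (meson mult_right_mono of_nat_le_iff order_trans)

definition one_plus_prod :: "('s \<times> 'a::ring_1) list \<Rightarrow> 'a"
  where "one_plus_prod ts = (\<Prod>(X, a)\<leftarrow>ts. 1 + a)"

lemma one_plus_prod_simps [simp]:
  "one_plus_prod [] = 1"
  "one_plus_prod ((X, a) # ts) = (1 + a) * one_plus_prod ts"
  "one_plus_prod (ts @ us) = one_plus_prod ts * one_plus_prod us"
  by (simp_all add: one_plus_prod_def)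

lemma supported_one_plus_prod:
  assumes "\<forall>(X, a)\<in>set ts. supported X a \<and> X \<subseteq> Y"
  shows "supported Y (one_plus_prod ts)"
  using assms
proof (induction ts)
  case (Cons t ts)
  then have "supported Y (one_plus_prod ts)" by simp
  moreover obtain X a where t: "t = (X, a)" "supported X a" "X \<subseteq> Y" using Cons.prems by auto
  then have "supported Y (1 + a)" by (simp add: supported_add supported_one supported_mono)
  ultimately show ?case by (simp add: t supported_mult)
qed (simp add: supported_one)

subsection \<open>Expansion of ordered products\<close>

text \<open>A factor \<open>1 + a\<close> that is still to be expanded, with the support of \<open>a\<close>, or a term already
  chosen from one.\<close>
datatype ('s, 'a) factor = Active 's 'a | Fixed 'a

primrec factor_value :: "('s, 'a::ring_1) factor \<Rightarrow> 'a" where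
  "factor_value (Active X a) = 1 + a"
| "factor_value (Fixed b) = b"

definition word_prod :: "('s, 'a::ring_1) factor list \<Rightarrow> 'a"
  where "word_prod w = prod_list (map factor_value w)"

fun active_terms :: "('s, 'a) factor list \<Rightarrow> ('s \<times> 'a) list" where
  "active_terms [] = []"
| "active_terms (Active X a # w) = (X, a) # active_terms w"
| "active_terms (Fixed b # w) = active_terms w"

fun fixed_values :: "('s, 'a) factor list \<Rightarrow> 'a list" where
  "fixed_values [] = []"
| "fixed_values (Active X a # w) = fixed_values w"
| "fixed_values (Fixed b # w) = b # fixed_values w"

lemma word_prod_simps [simp]:
  "word_prod [] = 1"
  "word_prod (Active X a # w) = (1 + a) * word_prod w"
  "word_prod (Fixed b # w) = b * word_prod w"
  "word_prod (w @ w') = word_prod w * word_prod w'"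
  by (simp_all add: word_prod_def)

lemma active_terms_append [simp]: "active_terms (w @ w') = active_terms w @ active_terms w'"
  by (induction w rule: active_terms.induct) auto

lemma fixed_values_append [simp]: "fixed_values (w @ w') = fixed_values w @ fixed_values w'"
  by (induction w rule: fixed_values.induct) auto

lemma set_active_terms: "(X, a) \<in> set (active_terms w) \<longleftrightarrow> Active X a \<in> set w"
  by (induction w rule: active_terms.induct) auto

abbreviation active_word :: "('s \<times> 'a) list \<Rightarrow> ('s, 'a) factor list"
  where "active_word ts \<equiv> map (case_prod Active) ts"

lemma active_word_simps [simp]:
  "active_terms (active_word ts) = ts"
  "fixed_values (active_word ts) = []"
  "word_prod (active_word ts) = one_plus_prod ts"
  by (induction ts) auto

lemma word_prod_separate:
  assumes "\<And>b. b \<in> set (fixed_values w) \<Longrightarrow> supported S b"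
    and "\<forall>(X, a)\<in>set (active_terms w). supported X a \<and> X \<inter> S = {}"
  shows "word_prod w = prod_list (fixed_values w) * one_plus_prod (active_terms w)"
  using assms
proof (induction w rule: active_terms.induct)
  case (2 X a w)
  have "a * prod_list (fixed_values w) = prod_list (fixed_values w) * a"
    using "2.prems"
    by (intro disjoint_supported_commute[of X _ S] supported_prod_list) simp_all
  then have "(1 + a) * (prod_list (fixed_values w) * c)
      = prod_list (fixed_values w) * ((1 + a) * c)" for c
    by (simp add: distrib_left distrib_right flip: mult.assoc)
  moreover have "word_prod w = prod_list (fixed_values w) * one_plus_prod (active_terms w)"
    using "2.prems" by (intro "2.IH") simp_all
  ultimately show ?case by simp
qed (simp_all add: mult.assoc)

text \<open>Expanding \<open>1 + a\<close> costs the factor \<open>(1 + 2 x) / (1 - 2 x)\<close> with \<open>x = \<parallel>a\<parallel>\<close>. It is at most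
  \<open>exp (c x)\<close> for small \<open>x\<close> as soon as \<open>c > 4\<close>; with \<open>c = 8\<close> the range \<open>x \<le> 1 / 4\<close> suffices.\<close>
definition expansion_bound ::
    "'v::finite set \<Rightarrow> ('v set, ('v \<Rightarrow> 'q::finite) cmat) factor list \<Rightarrow> bool"
  where "expansion_bound S w \<longleftrightarrow>
    norm (ntrace (word_prod w)) \<le> (\<Prod>b\<leftarrow>fixed_values w. norm b)
      * exp (8 * overlap_norm S (active_terms w)) * norm (ntrace (one_plus_prod (active_terms w)))"

lemma norm_prod_list_le:
  fixes as :: "'a::real_normed_algebra_1 list"
  shows "norm (prod_list as) \<le> (\<Prod>a\<leftarrow>as. norm a)"
  by (induction as) (auto intro!: order_trans[OF norm_mult_ineq] mult_left_mono)

lemma prod_list_norm_nonneg: "0 \<le> (\<Prod>a\<leftarrow>as. norm a)"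
  by (induction as) auto

lemma expansion_bound_disjoint:
  assumes fixed: "\<And>b. b \<in> set (fixed_values w) \<Longrightarrow> supported S b"
    and active: "\<forall>(X, a)\<in>set (active_terms w). supported X a \<and> X \<inter> S = {}"
  shows "expansion_bound S w"
proof -
  have "supported (- S) (one_plus_prod (active_terms w))"
    using active by (intro supported_one_plus_prod) blast
  moreover have "supported S (prod_list (fixed_values w))"
    using fixed by (rule supported_prod_list)
  moreover have "word_prod w = prod_list (fixed_values w) * one_plus_prod (active_terms w)"
    using assms by (rule word_prod_separate)
  ultimately have "norm (ntrace (word_prod w))
      = norm (ntrace (prod_list (fixed_values w))) * norm (ntrace (one_plus_prod (active_terms w)))"
    by (simp add: ntrace_mult_disjoint_supported[of S _ "- S"] norm_mult)
  also have "norm (ntrace (prod_list (fixed_values w))) \<le> (\<Prod>b\<leftarrow>fixed_values w. norm b)"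
    by (rule order_trans[OF norm_ntrace_le norm_prod_list_le])
  also have "\<dots> \<le> (\<Prod>b\<leftarrow>fixed_values w. norm b) * exp (8 * overlap_norm S (active_terms w))"
    using prod_list_norm_nonneg[of "fixed_values w"] overlap_norm_nonneg[of S "active_terms w"]
    by (simp add: mult_le_cancel_left1)
  finally show ?thesis
    unfolding expansion_bound_def by (simp add: mult_right_mono)
qed

lemma one_plus_le_exp_mult_one_minus:
  fixes x :: real
  assumes "0 \<le> x" "x \<le> 1 / 4"
  shows "1 + 2 * x \<le> exp (8 * x) * (1 - 2 * x)"
proof -
  have "x * x \<le> x * (1 / 4)" using assms by (intro mult_left_mono)
  then have "1 + 2 * x \<le> (1 + 8 * x) * (1 - 2 * x)" by (simp add: algebra_simps)
  also have "\<dots> \<le> exp (8 * x) * (1 - 2 * x)"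
    using assms exp_ge_add_one_self[of "8 * x"] by (intro mult_right_mono) auto
  finally show ?thesis .
qed

lemma exp_8_mult_le_2:
  fixes x :: real
  assumes "x \<le> 1 / 16"
  shows "exp (8 * x) \<le> 2"
proof -
  have "exp (8 * x) \<le> exp (1 / 2)" using assms by simp
  also have "\<dots> \<le> 2" by (rule exp_half_le2)
  finally show ?thesis .
qed

lemma norm_ntrace_one_plus_prod_insert_ge:
  assumes bound: "expansion_bound X (active_word ts @ Fixed a # active_word us)"
    and overlap: "overlap_norm X (ts @ us) \<le> 1 / 16"
  shows "(1 - 2 * norm a) * norm (ntrace (one_plus_prod (ts @ us)))
    \<le> norm (ntrace (one_plus_prod (ts @ (X, a) # us)))"
proof -
  define Z where "Z = norm (ntrace (one_plus_prod (ts @ us)))"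
  have "norm (ntrace (one_plus_prod ts * a * one_plus_prod us))
      \<le> norm a * exp (8 * overlap_norm X (ts @ us)) * Z"
    using bound by (simp add: expansion_bound_def Z_def mult.assoc)
  also have "\<dots> \<le> norm a * 2 * Z"
    using exp_8_mult_le_2[OF overlap] by (intro mult_right_mono mult_left_mono) (auto simp: Z_def)
  finally have "norm (ntrace (one_plus_prod ts * a * one_plus_prod us)) \<le> norm a * 2 * Z" .
  moreover have "one_plus_prod (ts @ (X, a) # us)
      = one_plus_prod (ts @ us) + one_plus_prod ts * a * one_plus_prod us"
    by (simp add: algebra_simps)
  ultimately show ?thesis
    using norm_diff_ineq[of "ntrace (one_plus_prod (ts @ us))"
        "ntrace (one_plus_prod ts * a * one_plus_prod us)"]
    by (simp only: ntrace_add) (simp add: Z_def algebra_simps)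
qed

lemma norm_ntrace_word_prod_insert_le:
  fixes X S :: "'v::finite set" and a :: "('v \<Rightarrow> 'q::finite) cmat"
  assumes deleted: "expansion_bound S (us @ vs)"
    and chosen: "expansion_bound (S \<union> X) (us @ Fixed a # vs)"
    and overlap: "overlap_norm X (active_terms (us @ vs)) \<le> 1 / 16"
  shows "norm (ntrace (word_prod (us @ Active X a # vs)))
    \<le> (\<Prod>b\<leftarrow>fixed_values (us @ vs). norm b) * exp (8 * overlap_norm S (active_terms (us @ vs)))
      * (1 + 2 * norm a) * norm (ntrace (one_plus_prod (active_terms (us @ vs))))"
proof -
  let ?ts = "active_terms (us @ vs)"
  let ?B = "\<Prod>b\<leftarrow>fixed_values (us @ vs). norm b" and ?e = "exp (8 * overlap_norm S ?ts)"
    and ?Z = "norm (ntrace (one_plus_prod ?ts))"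
  have "exp (8 * overlap_norm (S \<union> X) ?ts) \<le> exp (8 * overlap_norm S ?ts + 8 * overlap_norm X ?ts)"
    using overlap_norm_Un_le[of S X ?ts] by simp
  also have "\<dots> \<le> ?e * 2"
    using exp_8_mult_le_2[OF overlap] by (simp add: exp_add)
  finally have union: "exp (8 * overlap_norm (S \<union> X) ?ts) \<le> ?e * 2" .
  have "word_prod (us @ Active X a # vs) = word_prod (us @ vs) + word_prod (us @ Fixed a # vs)"
    by (simp add: algebra_simps)
  then have "norm (ntrace (word_prod (us @ Active X a # vs)))
      \<le> norm (ntrace (word_prod (us @ vs))) + norm (ntrace (word_prod (us @ Fixed a # vs)))"
    by (simp only: ntrace_add norm_triangle_ineq)
  also have "\<dots> \<le> ?B * ?e * ?Z + norm a * ?B * exp (8 * overlap_norm (S \<union> X) ?ts) * ?Z"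
    using deleted chosen by (intro add_mono) (simp_all add: expansion_bound_def mult_ac)
  also have "\<dots> \<le> ?B * ?e * ?Z + norm a * ?B * (?e * 2) * ?Z"
    using union by (intro add_left_mono mult_right_mono mult_left_mono mult_nonneg_nonneg
        prod_list_norm_nonneg) auto
  also have "\<dots> = ?B * ?e * (1 + 2 * norm a) * ?Z" by (simp add: algebra_simps)
  finally show ?thesis .
qed

lemma expansion_bound_step:
  fixes X S :: "'v::finite set" and a :: "('v \<Rightarrow> 'q::finite) cmat"
  assumes overlap: "overlap_norm X (active_terms us @ (X, a) # active_terms vs) \<le> 1 / 16"
    and meets: "X \<inter> S \<noteq> {}"
    and deleted: "expansion_bound S (us @ vs)"
    and chosen: "expansion_bound (S \<union> X) (us @ Fixed a # vs)"
    and alone: "expansion_bound X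
      (active_word (active_terms us) @ Fixed a # active_word (active_terms vs))"
  shows "expansion_bound S (us @ Active X a # vs)"
proof -
  let ?ts = "active_terms us @ active_terms vs"
    and ?ts' = "active_terms us @ (X, a) # active_terms vs"
  define B where "B = (\<Prod>b\<leftarrow>fixed_values (us @ vs). norm b)"
  define Z where "Z = norm (ntrace (one_plus_prod ?ts))"
  define e where "e = exp (8 * overlap_norm S ?ts)"
  have nonneg: "0 \<le> B" "0 \<le> Z" "0 \<le> e"
    by (simp_all add: B_def Z_def e_def prod_list_norm_nonneg)
  have "X \<inter> X \<noteq> {}" using meets by blast
  then have "norm a + overlap_norm X ?ts \<le> 1 / 16"
    using overlap_norm_insert_ge[of X X a] overlap order_trans by blast
  then have small: "norm a \<le> 1 / 4" "overlap_norm X ?ts \<le> 1 / 16"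
    using norm_ge_zero[of a] overlap_norm_nonneg[of X ?ts] by linarith+
  have "norm (ntrace (word_prod (us @ Active X a # vs))) \<le> B * e * (1 + 2 * norm a) * Z"
    using norm_ntrace_word_prod_insert_le[OF deleted chosen] small(2)
    by (simp add: B_def Z_def e_def)
  also have "\<dots> \<le> B * e * (exp (8 * norm a) * (1 - 2 * norm a)) * Z"
    using one_plus_le_exp_mult_one_minus[OF norm_ge_zero small(1)] nonneg
    by (intro mult_right_mono mult_left_mono) auto
  also have "\<dots> = B * exp (8 * (norm a + overlap_norm S ?ts)) * ((1 - 2 * norm a) * Z)"
    by (simp add: e_def distrib_left exp_add mult_ac)
  also have "\<dots> \<le> B * exp (8 * overlap_norm S ?ts') * norm (ntrace (one_plus_prod ?ts'))"
    using overlap_norm_insert_ge[OF meets, of a "active_terms us" "active_terms vs"]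
      norm_ntrace_one_plus_prod_insert_ge[OF alone small(2)] nonneg small(1)
    by (intro mult_mono) (simp_all add: Z_def)
  finally show ?thesis
    by (simp add: expansion_bound_def B_def)
qed

lemma local_terms_imp_expansion_bound:
  fixes \<eta> :: real
  assumes "local_terms k \<eta> (active_terms w)" and small: "k * \<eta> \<le> 1 / 16"
    and "\<And>b. b \<in> set (fixed_values w) \<Longrightarrow> supported S b"
  shows "expansion_bound S w"
  using assms(1,3)
proof (induction "length (active_terms w)" arbitrary: S w rule: less_induct)
  case less
  note terms = less.prems(1) and fixed = less.prems(2)
  show ?case
  proof (cases "\<exists>(X, a)\<in>set (active_terms w). X \<inter> S \<noteq> {}")
    case False
    then show ?thesis
      using local_termsD[OF terms] fixed by (intro expansion_bound_disjoint) auto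
  next
    case True
    then obtain X a where a: "(X, a) \<in> set (active_terms w)" and meets: "X \<inter> S \<noteq> {}" by blast
    obtain us vs where w: "w = us @ Active X a # vs"
      using a unfolding set_active_terms by (meson split_list)
    have rest: "local_terms k \<eta> (active_terms us @ active_terms vs)"
      using terms w by (auto intro: local_terms_delete)
    have supp: "supported X a" "card X \<le> k"
      using local_termsD[OF terms a] by auto
    show ?thesis
      unfolding w
    proof (rule expansion_bound_step[OF _ meets])
      show "overlap_norm X (active_terms us @ (X, a) # active_terms vs) \<le> 1 / 16"
        using overlap_norm_le[OF terms supp(2)] small by (simp add: w)
      show "expansion_bound S (us @ vs)"
        using rest fixed by (intro less.hyps) (auto simp: w)
      show "expansion_bound (S \<union> X) (us @ Fixed a # vs)"
        using rest fixed supp by (intro less.hyps) (auto simp: w intro: supported_mono)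
      show "expansion_bound X
          (active_word (active_terms us) @ Fixed a # active_word (active_terms vs))"
        using rest supp by (intro less.hyps) (auto simp: w)
    qed
  qed
qed

lemma norm_ntrace_mult_one_plus_prod_le:
  fixes \<eta> :: real
  assumes "local_terms k \<eta> ts" "k * \<eta> \<le> 1 / 16" "supported S b"
  shows "norm (ntrace (b * one_plus_prod ts))
    \<le> norm b * exp (8 * (card S * \<eta>)) * norm (ntrace (one_plus_prod ts))"
proof -
  have "norm (ntrace (b * one_plus_prod ts))
      \<le> norm b * exp (8 * overlap_norm S ts) * norm (ntrace (one_plus_prod ts))"
    using local_terms_imp_expansion_bound[of k \<eta> "Fixed b # active_word ts" S] assms
    by (simp add: expansion_bound_def)
  also have "\<dots> \<le> norm b * exp (8 * (card S * \<eta>)) * norm (ntrace (one_plus_prod ts))"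
    using overlap_norm_le_card[OF assms(1)] by (intro mult_right_mono mult_left_mono) auto
  finally show ?thesis .
qed

subsection \<open>Approximation of exponentials by ordered products\<close>

definition sum_terms :: "('s \<times> 'a::monoid_add) list \<Rightarrow> 'a"
  where "sum_terms ts = (\<Sum>(X, a)\<leftarrow>ts. a)"

definition scale_terms :: "complex \<Rightarrow> ('s \<times> 'n::finite cmat) list \<Rightarrow> ('s \<times> 'n cmat) list"
  where "scale_terms z ts = map (\<lambda>(X, a). (X, cscale z a)) ts"

lemma sum_terms_scale_terms: "sum_terms (scale_terms z ts) = cscale z (sum_terms ts)"
  by (induction ts) (auto simp: sum_terms_def scale_terms_def cscale_def distrib_left)

lemma local_terms_scale:
  assumes "local_terms k \<eta> ts"
  shows "local_terms k (norm z * \<eta>) (scale_terms z ts)"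
proof -
  have "site_norm (scale_terms z ts) v \<le> norm z * site_norm ts v" for v
    unfolding scale_terms_def
    by (induction ts) (auto simp: distrib_left intro!: add_mono norm_cscale_le)
  then have "site_norm (scale_terms z ts) v \<le> norm z * \<eta>" for v
    using assms by (meson local_terms_def mult_left_mono norm_ge_zero order_trans)
  then show ?thesis
    using assms by (auto simp: local_terms_def scale_terms_def intro: supported_cscale)
qed

lemma local_terms_concat_replicate:
  fixes \<eta> :: real
  assumes "local_terms k \<eta> ts"
  shows "local_terms k (n * \<eta>) (concat (replicate n ts))"
proof (induction n)
  case 0
  show ?case by (simp add: local_terms_def)
next
  case (Suc n)
  then show ?case using local_terms_append[OF assms Suc] by (simp add: distrib_right)
qed

definition trotter_terms :: "nat \<Rightarrow> ('s \<times> 'n::finite cmat) list \<Rightarrow> ('s \<times> 'n cmat) list"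
  where "trotter_terms n ts = concat (replicate n (scale_terms (1 / of_nat n) ts))"

lemma local_terms_trotter_terms:
  assumes "local_terms k \<eta> ts"
  shows "local_terms k \<eta> (trotter_terms n ts)"
proof (cases "n = 0")
  case True
  then show ?thesis
    using local_terms_nonneg[OF assms] by (simp add: trotter_terms_def local_terms_def)
next
  case False
  then show ?thesis
    using local_terms_concat_replicate[OF local_terms_scale[OF assms, of "1 / of_nat n"], of n]
    by (simp add: trotter_terms_def norm_divide)
qed

lemma one_plus_prod_trotter_terms_tendsto:
  fixes ts :: "('s \<times> 'n::finite cmat) list"
  shows "(\<lambda>n. one_plus_prod (trotter_terms n ts)) \<longlonglongrightarrow> exp (sum_terms ts)"
proof -
  have "one_plus_prod (concat (replicate m us)) = one_plus_prod us ^ m"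
    for m and us :: "('s \<times> 'n cmat) list"
    by (induction m) simp_all
  moreover have "cscale (1 / of_nat n) a = a /\<^sub>R real n" for n and a :: "'n cmat"
    using cscale_of_real[of "1 / real n"] by (simp add: inverse_eq_divide)
  ultimately have "one_plus_prod (trotter_terms n ts) = (\<Prod>a\<leftarrow>map snd ts. 1 + a /\<^sub>R real n) ^ n" for n
    by (simp add: trotter_terms_def scale_terms_def one_plus_prod_def o_def split_def)
  moreover have "sum_terms ts = sum_list (map snd ts)"
    by (simp add: sum_terms_def split_def)
  ultimately show ?thesis
    by (simp only: exp_sum_list_product_formula)
qed

subsection \<open>The locality estimate\<close>

lemma norm_ntrace_mult_exp_sum_terms_le:
  fixes \<eta> \<theta> :: real
  assumes ts: "local_terms k \<eta> ts" and us: "local_terms k \<theta> us"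
    and small: "k * (\<eta> + \<theta>) \<le> 1 / 16" and b: "supported S b"
  defines "W \<equiv> exp (sum_terms ts) * exp (sum_terms us)"
  shows "norm (ntrace (b * W)) \<le> norm b * exp (8 * (card S * (\<eta> + \<theta>))) * norm (ntrace W)"
proof (rule LIMSEQ_le)
  let ?P = "\<lambda>n. one_plus_prod (trotter_terms n ts @ trotter_terms n us)"
  let ?c = "norm b * exp (8 * (card S * (\<eta> + \<theta>)))"
  have P: "?P \<longlonglongrightarrow> W"
    unfolding one_plus_prod_simps W_def by (intro tendsto_mult one_plus_prod_trotter_terms_tendsto)
  show "(\<lambda>n. norm (ntrace (b * ?P n))) \<longlonglongrightarrow> norm (ntrace (b * W))"
    by (intro tendsto_norm bounded_linear.tendsto[OF bounded_linear_ntrace] tendsto_mult_left P)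
  show "(\<lambda>n. ?c * norm (ntrace (?P n))) \<longlonglongrightarrow> ?c * norm (ntrace W)"
    by (intro tendsto_mult_left tendsto_norm bounded_linear.tendsto[OF bounded_linear_ntrace] P)
  have "local_terms k (\<eta> + \<theta>) (trotter_terms n ts @ trotter_terms n us)" for n
    by (intro local_terms_append local_terms_trotter_terms ts us)
  then show "\<exists>N. \<forall>n\<ge>N. norm (ntrace (b * ?P n)) \<le> ?c * norm (ntrace (?P n))"
    using norm_ntrace_mult_one_plus_prod_le[OF _ small b] by blast
qed

lemma ntrace_exp_sum_terms_nonzero:
  fixes \<eta> \<theta> :: real
  assumes "local_terms k \<eta> ts" "local_terms k \<theta> us" "k * (\<eta> + \<theta>) \<le> 1 / 16"
  shows "ntrace (exp (sum_terms ts) * exp (sum_terms us)) \<noteq> 0"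
proof
  \<comment> \<open>Test the locality estimate with the inverse, viewed as supported on all sites.\<close>
  let ?F = "sum_terms ts" and ?H = "sum_terms us"
  assume "ntrace (exp ?F * exp ?H) = 0"
  then have "norm (ntrace (exp (- ?H) * exp (- ?F) * (exp ?F * exp ?H))) \<le> 0"
    using norm_ntrace_mult_exp_sum_terms_le[OF assms supported_UNIV, of "exp (- ?H) * exp (- ?F)"]
    by simp
  moreover have "exp (- ?H) * exp (- ?F) * (exp ?F * exp ?H)
      = exp (- ?H) * (exp (- ?F) * exp ?F) * exp ?H"
    by (simp add: mult.assoc)
  ultimately show False
    using exp_minus_inverse[of "- ?F"] exp_minus_inverse[of "- ?H"] by (simp add: ntrace_one)
qed

lemma norm_ntrace_mult_exp_sum_terms_le_2:
  fixes \<eta> \<theta> :: real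
  assumes ts: "local_terms k \<eta> ts" and us: "local_terms k \<theta> us"
    and small: "k * (\<eta> + \<theta>) \<le> 1 / 16" and b: "supported S b" "card S \<le> k"
  defines "W \<equiv> exp (sum_terms ts) * exp (sum_terms us)"
  shows "norm (ntrace (b * W)) \<le> 2 * norm b * norm (ntrace W)"
proof -
  have "card S * (\<eta> + \<theta>) \<le> k * (\<eta> + \<theta>)"
    using b local_terms_nonneg[OF ts] local_terms_nonneg[OF us] by (intro mult_right_mono) auto
  then have "exp (8 * (card S * (\<eta> + \<theta>))) \<le> 2"
    using small by (intro exp_8_mult_le_2) linarith
  then have "norm b * exp (8 * (card S * (\<eta> + \<theta>))) * norm (ntrace W) \<le> norm b * 2 * norm (ntrace W)"
    by (intro mult_right_mono mult_left_mono) auto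
  then show ?thesis
    using norm_ntrace_mult_exp_sum_terms_le[OF ts us small b(1)] by (simp add: W_def mult_ac)
qed

lemma norm_ntrace_sum_terms_mult_exp_le:
  fixes \<eta> \<theta> \<gamma> :: real
  assumes "local_terms k \<eta> ts" "local_terms k \<theta> us" "k * (\<eta> + \<theta>) \<le> 1 / 16"
    and bs: "local_terms k \<gamma> bs"
  defines "W \<equiv> exp (sum_terms ts) * exp (sum_terms us)"
  shows "norm (ntrace (sum_terms bs * W)) \<le> 2 * (\<Sum>(X, b)\<leftarrow>bs. norm b) * norm (ntrace W)"
proof -
  have "\<forall>(X, b)\<in>set bs. supported X b \<and> card X \<le> k"
    using bs by (simp add: local_terms_def)
  then show ?thesis
  proof (induction bs)
    case Nil
    show ?case by (simp add: sum_terms_def linear_0[OF linear_ntrace])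
  next
    case (Cons t bs)
    obtain X b where t: "t = (X, b)" by fastforce
    have "norm (ntrace (b * W)) \<le> 2 * norm b * norm (ntrace W)"
      unfolding W_def using Cons.prems
      by (intro norm_ntrace_mult_exp_sum_terms_le_2[OF assms(1-3)]) (auto simp: t)
    moreover have "ntrace (sum_terms (t # bs) * W) = ntrace (b * W) + ntrace (sum_terms bs * W)"
      by (simp add: t sum_terms_def distrib_right ntrace_add)
    ultimately have "norm (ntrace (sum_terms (t # bs) * W))
        \<le> 2 * norm b * norm (ntrace W) + 2 * (\<Sum>(X, b)\<leftarrow>bs. norm b) * norm (ntrace W)"
      using Cons by (auto intro: norm_triangle_mono)
    then show ?case by (simp add: t algebra_simps)
  qed
qed

lemma
  fixes g \<theta> R :: real
  assumes fs: "local_terms k g fs" and hs: "local_terms k \<theta> hs"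
    and small: "k * (R * g + \<theta>) \<le> 1 / 16" and z: "norm z \<le> R"
  defines "W \<equiv> exp (cscale z (sum_terms fs)) * exp (sum_terms hs)"
  shows ntrace_exp_cscale_sum_terms_nonzero: "ntrace W \<noteq> 0"
    and norm_ntrace_sum_terms_mult_exp_cscale_le:
      "norm (ntrace (sum_terms fs * W)) \<le> 2 * (\<Sum>(X, a)\<leftarrow>fs. norm a) * norm (ntrace W)"
proof -
  have "norm z * g + \<theta> \<le> R * g + \<theta>"
    using z local_terms_nonneg[OF fs] by (simp add: mult_right_mono)
  then have small': "k * (norm z * g + \<theta>) \<le> 1 / 16"
    using small by (meson mult_left_mono of_nat_0_le_iff order_trans)
  show "ntrace W \<noteq> 0"
    using ntrace_exp_sum_terms_nonzero[OF local_terms_scale[OF fs] hs small']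
    by (simp add: W_def sum_terms_scale_terms)
  show "norm (ntrace (sum_terms fs * W)) \<le> 2 * (\<Sum>(X, a)\<leftarrow>fs. norm a) * norm (ntrace W)"
    using norm_ntrace_sum_terms_mult_exp_le[OF local_terms_scale[OF fs] hs small' fs]
    by (simp add: W_def sum_terms_scale_terms)
qed

subsection \<open>Thermal means\<close>

definition thermal_mean :: "'n::finite cmat \<Rightarrow> 'n cmat \<Rightarrow> real"
  where "thermal_mean h a = Re (ntrace (a * exp h)) / Re (ntrace (exp h))"

lemma ln_thermal_mean_exp_le:
  fixes g \<theta> R \<tau> :: real
  assumes fs: "local_terms k g fs" and hs: "local_terms k \<theta> hs"
    and herm: "hermitian_cmat (sum_terms fs)" "hermitian_cmat (sum_terms hs)"
    and small: "k * (R * g + \<theta>) \<le> 1 / 16" and \<tau>: "\<bar>\<tau>\<bar> < R"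
  shows "ln (thermal_mean (sum_terms hs) (exp (\<tau> *\<^sub>R sum_terms fs)))
    \<le> \<tau> * thermal_mean (sum_terms hs) (sum_terms fs) + \<tau>\<^sup>2 * (\<Sum>(X, a)\<leftarrow>fs. norm a) / (R - \<bar>\<tau>\<bar>)"
proof -
  let ?F = "sum_terms fs" and ?E = "exp (sum_terms hs)" and ?\<Phi> = "\<Sum>(X, a)\<leftarrow>fs. norm a"
  define Z where "Z = (\<lambda>z. ntrace (exp (cscale z ?F) * ?E))"
  define Z' where "Z' = (\<lambda>z. ntrace (?F * exp (cscale z ?F) * ?E))"
  have Z_real: "Z (of_real t) = ntrace (exp (t *\<^sub>R ?F) * ?E)" for t
    by (simp add: Z_def cscale_of_real)
  then have Z_0: "Z 0 = ntrace ?E"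
    using Z_real[of 0] by simp
  obtain r where r: "0 < r" "Z (of_real \<tau>) = complex_of_real r"
    using ntrace_exp_mult_exp_pos[OF hermitian_cmat_scaleR[OF herm(1)] herm(2)]
    unfolding Z_real by metis
  obtain s where s: "0 < s" "Z 0 = complex_of_real s"
    using ntrace_exp_mult_exp_pos[OF hermitian_cmat_scaleR[OF herm(1), of 0] herm(2)]
    unfolding Z_0 by auto
  have "ln (norm (Z (of_real \<tau>))) \<le> ln (norm (Z 0)) + Re (Z' 0 / Z 0 * (of_real \<tau> - 0))
      + 2 * ?\<Phi> / 2 * (dist 0 (complex_of_real \<tau>))\<^sup>2 / (R - dist 0 (complex_of_real \<tau>))"
  proof (rule ln_norm_le_second_order)
    fix z :: complex
    assume "z \<in> ball 0 R"
    then have z: "norm z \<le> R" by simp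
    show "(Z has_field_derivative Z' z) (at z)"
      unfolding Z_def Z'_def by (rule has_field_derivative_ntrace_exp_cscale)
    show "Z z \<noteq> 0"
      unfolding Z_def by (rule ntrace_exp_cscale_sum_terms_nonzero[OF fs hs small z])
    show "norm (Z' z) \<le> 2 * ?\<Phi> * norm (Z z)"
      unfolding Z_def Z'_def mult.assoc[of ?F]
      by (rule norm_ntrace_sum_terms_mult_exp_cscale_le[OF fs hs small z])
  qed (use \<tau> in simp)
  then have "ln (r / s) \<le> \<tau> * (Re (Z' 0) / s) + \<tau>\<^sup>2 * ?\<Phi> / (R - \<bar>\<tau>\<bar>)"
    using r s by (simp add: ln_div mult_ac)
  moreover have "thermal_mean (sum_terms hs) (exp (\<tau> *\<^sub>R ?F)) = r / s"
    unfolding thermal_mean_def Z_real[symmetric] Z_0[symmetric] r s by simp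
  moreover have "thermal_mean (sum_terms hs) ?F = Re (Z' 0) / s"
    unfolding thermal_mean_def Z_0[symmetric] s using cscale_of_real[of 0 ?F] by (simp add: Z'_def)
  ultimately show ?thesis by simp
qed

lemma Re_trace_gibbs_state:
  fixes a h :: "'n::finite cmat"
  defines "E \<equiv> mat_exp (matrix_of h)"
  shows "Re (trace (matrix_of a ** ((1 / Re (trace E)) *\<^sub>R E))) = thermal_mean h a"
proof -
  have E: "E = matrix_of (exp h)"
    by (simp add: E_def matrix_of_exp)
  define c where "c = 1 / Re (trace E)"
  have "matrix_of a ** (c *\<^sub>R E) = matrix_of (c *\<^sub>R (a * exp h))"
    by (simp only: E flip: times_cmat.rep_eq scaleR_cmat.rep_eq mult_scaleR_right)
  then have "trace (matrix_of a ** (c *\<^sub>R E)) = of_nat CARD('n) * ntrace (c *\<^sub>R (a * exp h))"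
    by (simp add: ntrace_def)
  also have "\<dots> = c *\<^sub>R (of_nat CARD('n) * ntrace (a * exp h))"
    by (simp add: ntrace_scaleR)
  finally show ?thesis
    by (simp add: c_def E thermal_mean_def ntrace_def)
qed

definition interaction_terms :: "'v::finite set list \<Rightarrow> ('v set \<Rightarrow> ('v, 'q::finite) op)
    \<Rightarrow> ('v set \<times> ('v \<Rightarrow> 'q) cmat) list"
  where "interaction_terms Xs f = map (\<lambda>X. (X, Cmat (f X))) Xs"

lemma local_terms_interaction:
  assumes "distinct Xs" and "\<And>X. X \<in> set Xs \<Longrightarrow> card X \<le> k"
    and "\<And>X. X \<in> set Xs \<Longrightarrow> supported_on X (f X)"
    and "\<And>v. (\<Sum>X | X \<in> set Xs \<and> v \<in> X. op_norm (f X)) \<le> g"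
  shows "local_terms k g (interaction_terms Xs f)"
proof -
  have "site_norm (interaction_terms Xs f) v = (\<Sum>X | X \<in> set Xs \<and> v \<in> X. op_norm (f X))" for v
    using \<open>distinct Xs\<close>
    by (simp add: site_norm_def interaction_terms_def o_def norm_cmat.rep_eq Cmat_inverse
        sum.inter_filter cong: if_cong flip: sum.distinct_set_conv_list)
  then show ?thesis
    using assms by (auto simp: local_terms_def interaction_terms_def supported_def Cmat_inverse)
qed

lemma sum_terms_interaction:
  assumes "distinct Xs"
  shows "sum_terms (interaction_terms Xs f) = (\<Sum>X\<in>set Xs. Cmat (f X))"
  using assms
  by (simp add: sum_terms_def interaction_terms_def o_def flip: sum.distinct_set_conv_list)

lemma matrix_of_sum_terms_interaction:
  assumes "distinct Xs"
  shows "matrix_of (sum_terms (interaction_terms Xs f)) = (\<Sum>X\<in>set Xs. f X)"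
  using assms by (simp add: sum_terms_interaction matrix_of_sum Cmat_inverse)

lemma hermitian_cmat_sum_terms_interaction:
  assumes "distinct Xs" "\<And>X. X \<in> set Xs \<Longrightarrow> hermitian (f X)"
  shows "hermitian_cmat (sum_terms (interaction_terms Xs f))"
  unfolding sum_terms_interaction[OF assms(1)]
  using assms(2) by (intro hermitian_cmat_sum) (simp add: hermitian_cmat_def Cmat_inverse)

lemma sum_list_norm_interaction:
  assumes "distinct Xs"
  shows "(\<Sum>(X, a)\<leftarrow>interaction_terms Xs f. norm a) = (\<Sum>X\<in>set Xs. op_norm (f X))"
  using assms
  by (simp add: interaction_terms_def o_def norm_cmat.rep_eq Cmat_inverse
      flip: sum.distinct_set_conv_list)

theorem theorem1:
  fixes h f :: "'v::finite set \<Rightarrow> ('v, 'q::finite) op"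
    and k :: nat and g \<beta> \<tau> :: real
  assumes k_pos: "k \<ge> 1" and g_pos: "g > 0"
    and h_herm: "\<And>X. card X \<le> k \<Longrightarrow> hermitian (h X)"
    and h_supp: "\<And>X. card X \<le> k \<Longrightarrow> supported_on X (h X)"
    and h_local: "\<And>v. (\<Sum>X\<in>{X. card X \<le> k \<and> v \<in> X}. op_norm (h X)) \<le> g"
    and f_herm: "\<And>X. card X \<le> k \<Longrightarrow> hermitian (f X)"
    and f_supp: "\<And>X. card X \<le> k \<Longrightarrow> supported_on X (f X)"
    and f_local: "\<And>v. (\<Sum>X\<in>{X. card X \<le> k \<and> v \<in> X}. op_norm (f X)) \<le> g"
    and beta_nonneg: "\<beta> \<ge> 0"
    and beta_small: "\<beta> < 1 / (8 * exp 3 * g * k)"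
    and tau_small: "\<bar>\<tau>\<bar> < 1 / (8 * exp 3 * g * k) - \<beta>"
  shows
    "let H = (\<Sum>X\<in>{X. card X \<le> k}. h X);
         F = (\<Sum>X\<in>{X. card X \<le> k}. f X);
         Fbar = (\<Sum>X\<in>{X. card X \<le> k}. op_norm (f X));
         Z = Re (trace (mat_exp ((- \<beta>) *\<^sub>R H)));
         \<rho> = (1 / Z) *\<^sub>R mat_exp ((- \<beta>) *\<^sub>R H);
         expF = Re (trace (F ** \<rho>));
         \<beta>c = 1 / (8 * exp 3 * g * k)
     in ln (Re (trace (mat_exp ((- \<tau>) *\<^sub>R F) ** \<rho>)))
          \<le> - \<tau> * expF + \<tau>\<^sup>2 * Fbar / (\<beta>c - \<beta> - \<bar>\<tau>\<bar>)"
proof -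
  define \<beta>c where "\<beta>c = 1 / (8 * exp 3 * g * k)"
  obtain Xs where Xs: "set Xs = {X :: 'v set. card X \<le> k}" "distinct Xs"
    using finite_distinct_list[of "{X :: 'v set. card X \<le> k}"] by auto
  let ?fs = "interaction_terms Xs f" and ?hs = "interaction_terms Xs h"
  let ?hs\<beta> = "scale_terms (of_real (- \<beta>)) ?hs"
  have H: "sum_terms ?hs\<beta> = (- \<beta>) *\<^sub>R sum_terms ?hs"
    unfolding sum_terms_scale_terms by (rule cscale_of_real)
  have local: "local_terms k g ?fs" "local_terms k g ?hs"
    using f_supp f_local h_supp h_local by (auto intro!: local_terms_interaction simp: Xs)
  have local\<beta>: "local_terms k (\<beta> * g) ?hs\<beta>"
    using local_terms_scale[OF local(2), of "of_real (- \<beta>)"] beta_nonneg by simp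
  have herm: "hermitian_cmat (sum_terms ?fs)" "hermitian_cmat (sum_terms ?hs\<beta>)"
    unfolding H using f_herm h_herm
    by (auto intro!: hermitian_cmat_scaleR hermitian_cmat_sum_terms_interaction
        simp: Xs simp del: scaleR_minus_left)
  have small: "k * ((\<beta>c - \<beta>) * g + \<beta> * g) \<le> 1 / 16"
    using k_pos g_pos exp_ge_add_one_self[of 3] by (simp add: \<beta>c_def field_simps)
  have \<tau>: "\<bar>- \<tau>\<bar> < \<beta>c - \<beta>"
    using tau_small by (simp add: \<beta>c_def)
  show ?thesis
    using ln_thermal_mean_exp_le[OF local(1) local\<beta> herm small \<tau>]
    unfolding Let_def \<beta>c_def Re_trace_gibbs_state[symmetric] H matrix_of_exp scaleR_cmat.rep_eq
      sum_list_norm_interaction[OF Xs(2)] matrix_of_sum_terms_interaction[OF Xs(2)] Xs(1)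
    by simp
qed

end
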